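(* Let $D>1$ be an integer and let $G$ be a finite $D$-quasirandom group. Let $f_1,f_2,f_3\colon G\to\mathbb{C}$ satisfy $\|f_i\|_\infty\le 1$ for $i=1,2,3$. Then \[\Big|\mathbb{E}_{x,y\sim G}\big[f_1(x)f_2(xy)f_3(xy^2)\big]-\prod_{i=1}^{3}\mathbb{E}_{x\sim G}\big[f_i(x)\big]\Big|\le\left(\frac{2}{\sqrt{D}}\right)^{1/4}.\]
   Context: A finite nonabelian group $G$ is called $D$-quasirandom (for an integer $D>1$) if every non-trivial irreducible complex representation of $G$ has dimension at least $D$. All expectations are with respect to the uniform distribution on $G$, and $\|f\|_\infty=\max_{x\in G}|f(x)|$. *)

theory Defs
  imports
    "HOL-Probability.Probability_Mass_Function"
    "Jordan_Normal_Form.VS_Connect"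
begin

definition GL :: "nat \<Rightarrow> complex mat monoid" where
  "GL d = units_of (ring_mat TYPE(complex) d ())"

text \<open>A complex representation of dimension \<open>d\<close> is taken on the coordinate space, i.e. it is a
  homomorphism into \<open>GL d\<close>. HOL cannot quantify over types inside a formula, and after a choice
  of basis every \<open>d\<close>-dimensional representation has this form.\<close>

definition is_rep :: "('a, 'b) monoid_scheme \<Rightarrow> nat \<Rightarrow> ('a \<Rightarrow> complex mat) \<Rightarrow> bool" where
  "is_rep G d \<rho> \<longleftrightarrow> \<rho> \<in> hom G (GL d)"

definition invariant_subspace ::
    "('a, 'b) monoid_scheme \<Rightarrow> nat \<Rightarrow> ('a \<Rightarrow> complex mat) \<Rightarrow> complex vec set \<Rightarrow> bool" where
  "invariant_subspace G d \<rho> W \<longleftrightarrow>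
     VectorSpace.subspace class_ring W (module_vec TYPE(complex) d) \<and>
     (\<forall>x\<in>carrier G. \<forall>w\<in>W. \<rho> x *\<^sub>v w \<in> W)"

definition irreducible_rep :: "('a, 'b) monoid_scheme \<Rightarrow> nat \<Rightarrow> ('a \<Rightarrow> complex mat) \<Rightarrow> bool" where
  "irreducible_rep G d \<rho> \<longleftrightarrow>
     is_rep G d \<rho> \<and> d > 0 \<and>
     (\<forall>W. invariant_subspace G d \<rho> W \<longrightarrow> W = {0\<^sub>v d} \<or> W = carrier_vec d)"

text \<open>An irreducible representation is isomorphic to the one-dimensional trivial representation
  exactly if every group element acts as the identity.\<close>

definition trivial_rep :: "('a, 'b) monoid_scheme \<Rightarrow> nat \<Rightarrow> ('a \<Rightarrow> complex mat) \<Rightarrow> bool" where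
  "trivial_rep G d \<rho> \<longleftrightarrow> (\<forall>x\<in>carrier G. \<rho> x = 1\<^sub>m d)"

definition quasirandom :: "nat \<Rightarrow> ('a, 'b) monoid_scheme \<Rightarrow> bool" where
  "quasirandom D G \<longleftrightarrow>
     group G \<and> finite (carrier G) \<and> \<not> comm_group G \<and>
     (\<forall>d \<rho>. irreducible_rep G d \<rho> \<and> \<not> trivial_rep G d \<rho> \<longrightarrow> D \<le> d)"

definition expect :: "'a set \<Rightarrow> ('a \<Rightarrow> complex) \<Rightarrow> complex" where
  "expect A f = measure_pmf.expectation (pmf_of_set A) f"

definition sup_norm :: "('a, 'b) monoid_scheme \<Rightarrow> ('a \<Rightarrow> complex) \<Rightarrow> real" where
  "sup_norm G f = Max ((\<lambda>x. norm (f x)) ` carrier G)"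

lemma expect_eq_average:
  assumes "finite A" "A \<noteq> {}"
  shows "expect A f = (\<Sum>x\<in>A. f x) / of_nat (card A)"
  unfolding expect_def using assms
  by (subst integral_measure_pmf[of A])
     (auto simp: sum_divide_distrib scaleR_conv_of_real divide_simps)

end

theory Submission
  imports Defs "HOL-Analysis.L2_Norm" "Jordan_Normal_Form.Spectral_Radius"
begin

text \<open>Subtracting its mean from \<open>f\<^sub>3\<close> leaves a mean-zero \<open>f\<close>; the mean part factors exactly
  because \<open>x\<close> and \<open>xy\<close> are independent. Two applications of Cauchy--Schwarz bound the fourth power
  of the remaining average by \<open>Q = E |\<langle>f, L\<^sub>g R\<^sub>h f\<rangle>|\<^sup>2\<close> over uniform pairs of conjugate elements
  \<open>g, h = u\<^sup>-\<^sup>1gu\<close>, where \<open>(L\<^sub>g R\<^sub>h f)(v) = f(gvh)\<close>. Put \<open>\<Phi>(v,w) = f(v) cnj (f(w))\<close>, let \<open>P\<close> average the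
  diagonal two-sided translations by conjugate pairs and \<open>K\<close> average the diagonal right translations by
  commutators \<open>[k,u]\<close>. Then \<open>Q = \<langle>\<Phi>, P\<Phi>\<rangle>\<close> and \<open>P\<^sup>2 = K P\<close>, so that \<open>Q \<le> \<parallel>P\<Phi>\<parallel> \<le> \<parallel>K\<Phi>\<parallel>\<close>.

  By Schur orthogonality \<open>K\<close> acts on an irreducible representation of dimension \<open>d\<close> as the scalar
  \<open>1/d\<^sup>2\<close>, so quasirandomness makes it small on mean-zero functions. The right-invariant part of \<open>\<Phi>\<close> is
  measured by the autocorrelations of \<open>f\<close>, and \<open>E\<^sub>g |\<langle>R\<^sub>g f, f\<rangle>|\<^sup>2 \<le> \<parallel>f\<parallel>\<^sup>4 / D\<close> follows by decomposing \<open>f\<close>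
  into irreducible components, again using Schur orthogonality. Together \<open>Q\<^sup>2 \<le> 2/D\<close>.\<close>

section \<open>Averages over a finite group\<close>

lemma sum_norm_mult_sq_le:
  fixes a b :: "'i \<Rightarrow> complex"
  shows "(norm (\<Sum>i\<in>I. a i * b i))\<^sup>2 \<le> (\<Sum>i\<in>I. (norm (a i))\<^sup>2) * (\<Sum>i\<in>I. (norm (b i))\<^sup>2)"
proof -
  have "norm (\<Sum>i\<in>I. a i * b i) \<le> (\<Sum>i\<in>I. norm (a i) * norm (b i))"
    by (rule order_trans[OF norm_sum]) (simp add: norm_mult)
  then have "(norm (\<Sum>i\<in>I. a i * b i))\<^sup>2 \<le> (\<Sum>i\<in>I. norm (a i) * norm (b i))\<^sup>2"
    by (rule power_mono) simp
  also have "\<dots> \<le> (\<Sum>i\<in>I. (norm (a i))\<^sup>2) * (\<Sum>i\<in>I. (norm (b i))\<^sup>2)"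
    by (rule Cauchy_Schwarz_ineq_sum)
  finally show ?thesis .
qed

section \<open>Invariant subspaces and the general linear group\<close>

lemma invariant_subspaceI:
  assumes "W \<subseteq> carrier_vec d" "0\<^sub>v d \<in> W"
    and "\<And>v w. v \<in> W \<Longrightarrow> w \<in> W \<Longrightarrow> v + w \<in> W"
    and "\<And>c v. v \<in> W \<Longrightarrow> c \<cdot>\<^sub>v v \<in> W"
    and "\<And>g v. g \<in> carrier G \<Longrightarrow> v \<in> W \<Longrightarrow> \<rho> g *\<^sub>v v \<in> W"
  shows "invariant_subspace G d \<rho> W"
proof -
  interpret vec_space "TYPE(complex)" d .
  have "submodule class_ring W (module_vec TYPE(complex) d)"
    using assms by unfold_locales (auto simp: module_vec_simps class_ring_simps)
  then show ?thesis
    unfolding invariant_subspace_def subspace_def using assms(5) vectorspace_axioms by auto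
qed

lemma GL_carrier: "A \<in> carrier (GL d) \<longleftrightarrow>
    A \<in> carrier_mat d d \<and> (\<exists>B\<in>carrier_mat d d. B * A = 1\<^sub>m d \<and> A * B = 1\<^sub>m d)"
  by (auto simp: GL_def units_of_def Units_def ring_mat_simps)

lemma GL_mult: "A \<otimes>\<^bsub>GL d\<^esub> B = A * B"
  by (simp add: GL_def units_of_def ring_mat_simps)

lemma GL_one: "\<one>\<^bsub>GL d\<^esub> = 1\<^sub>m d"
  by (simp add: GL_def units_of_def ring_mat_simps)

lemma GL_group: "group (GL d)"
proof -
  interpret ring "ring_mat TYPE(complex) d ()" by (rule ring_mat)
  show ?thesis unfolding GL_def by (rule units_group)
qed

section \<open>Uniform averages and changes of variable\<close>

locale fin_group = group +
  assumes fin: "finite (carrier G)"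
begin

text \<open>Polymorphic in the field, so that one set of rules serves complex values and their real
  squared norms; \<open>of_real_avg\<close> passes between the two.\<close>

definition avg :: "('a \<Rightarrow> 'c::real_normed_field) \<Rightarrow> 'c" where
  "avg F = (\<Sum>x\<in>carrier G. F x) / of_nat (card (carrier G))"

lemma card_pos: "card (carrier G) > 0"
  using fin by (simp add: card_gt_0_iff) (use one_closed in blast)

lemma avg_cong: "(\<And>x. x \<in> carrier G \<Longrightarrow> F x = F' x) \<Longrightarrow> avg F = avg F'"
  by (simp add: avg_def)

lemma avg_add: "avg (\<lambda>x. F x + F' x) = avg F + avg F'"
  by (simp add: avg_def sum.distrib add_divide_distrib)

lemma avg_diff: "avg (\<lambda>x. F x - F' x) = avg F - avg F'"
  by (simp add: avg_def sum_subtractf diff_divide_distrib)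

lemma avg_sum: "avg (\<lambda>x. \<Sum>i\<in>I. F i x) = (\<Sum>i\<in>I. avg (F i))"
  unfolding avg_def by (subst sum.swap) (simp add: sum_divide_distrib)

lemma avg_cmult: "avg (\<lambda>x. c * F x) = c * avg F"
  by (simp add: avg_def sum_distrib_left)

lemma avg_multc: "avg (\<lambda>x. F x * c) = avg F * c"
  by (simp add: avg_def sum_distrib_right)

lemma avg_const [simp]: "avg (\<lambda>x. c) = c"
  using card_pos by (simp add: avg_def)

lemma avg_swap: "avg (\<lambda>x. avg (\<lambda>y. F x y)) = avg (\<lambda>y. avg (\<lambda>x. F x y))"
  unfolding avg_def by (simp only: sum_divide_distrib[symmetric], subst sum.swap, rule refl)

lemma cnj_avg: "cnj (avg F) = avg (\<lambda>x. cnj (F x))"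
  by (simp add: avg_def)

lemma of_real_avg: "of_real (avg F) = avg (\<lambda>x. of_real (F x))"
  by (simp add: avg_def)

lemma avg_mono: "(\<And>x. x \<in> carrier G \<Longrightarrow> F x \<le> F' x) \<Longrightarrow> avg F \<le> (avg F' :: real)"
  by (auto simp: avg_def intro!: divide_right_mono sum_mono)

lemma avg_nonneg: "(\<And>x. x \<in> carrier G \<Longrightarrow> 0 \<le> F x) \<Longrightarrow> 0 \<le> (avg F :: real)"
  by (auto simp: avg_def intro!: divide_nonneg_nonneg sum_nonneg)

lemma avg_reindex:
  assumes "bij_betw p (carrier G) (carrier G)"
  shows "avg (\<lambda>x. F (p x)) = avg F"
  unfolding avg_def using sum.reindex_bij_betw[OF assms, of F] by simp

lemma l_cancel_inv [simp]:
  "x \<in> carrier G \<Longrightarrow> y \<in> carrier G \<Longrightarrow> inv x \<otimes> (x \<otimes> y) = y"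
  "x \<in> carrier G \<Longrightarrow> y \<in> carrier G \<Longrightarrow> x \<otimes> (inv x \<otimes> y) = y"
  by (simp_all flip: m_assoc)

lemma avg_right: "h \<in> carrier G \<Longrightarrow> avg (\<lambda>x. F (x \<otimes> h)) = avg F"
  by (rule avg_reindex, rule bij_betw_byWitness[where f' = "\<lambda>x. x \<otimes> inv h"])
     (auto simp: m_assoc)

lemma avg_left: "h \<in> carrier G \<Longrightarrow> avg (\<lambda>x. F (h \<otimes> x)) = avg F"
  by (rule avg_reindex, rule bij_betw_byWitness[where f' = "\<lambda>x. inv h \<otimes> x"])
     (auto simp: m_assoc)

lemma avg_conj: "h \<in> carrier G \<Longrightarrow> avg (\<lambda>x. F (h \<otimes> x \<otimes> inv h)) = avg F"
  using avg_right[of "inv h" "\<lambda>x. F (h \<otimes> x)"] avg_left[of h F]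
  by (simp add: m_assoc cong: avg_cong)

lemma avg_cauchy_schwarz:
  fixes a b :: "'a \<Rightarrow> complex"
  shows "(norm (avg (\<lambda>x. a x * b x)))\<^sup>2 \<le> avg (\<lambda>x. (norm (a x))\<^sup>2) * avg (\<lambda>x. (norm (b x))\<^sup>2)"
proof -
  have "(norm (\<Sum>i\<in>carrier G. a i * b i))\<^sup>2 / (real (card (carrier G)))\<^sup>2
     \<le> (\<Sum>i\<in>carrier G. (norm (a i))\<^sup>2) * (\<Sum>i\<in>carrier G. (norm (b i))\<^sup>2) / (real (card (carrier G)))\<^sup>2"
    by (intro divide_right_mono sum_norm_mult_sq_le) simp
  then show ?thesis by (simp add: avg_def norm_divide power_divide power2_eq_square)
qed

section \<open>Averages over pairs of group elements\<close>

definition avg2 :: "('a \<Rightarrow> 'a \<Rightarrow> 'c::real_normed_field) \<Rightarrow> 'c" where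
  "avg2 F = avg (\<lambda>x. avg (\<lambda>y. F x y))"

lemma avg2_eq_sum: "avg2 F = (\<Sum>p\<in>carrier G \<times> carrier G. F (fst p) (snd p)) / of_nat (card (carrier G))^2"
  unfolding avg2_def avg_def
  by (simp add: sum_divide_distrib[symmetric] sum.cartesian_product case_prod_unfold power2_eq_square)

lemma avg2_cauchy_schwarz:
  fixes a b :: "'a \<Rightarrow> 'a \<Rightarrow> complex"
  shows "(norm (avg2 (\<lambda>x y. a x y * b x y)))\<^sup>2
    \<le> avg2 (\<lambda>x y. (norm (a x y))\<^sup>2) * avg2 (\<lambda>x y. (norm (b x y))\<^sup>2)"
proof -
  let ?P = "carrier G \<times> carrier G" and ?n = "real (card (carrier G))"
  have "(norm (\<Sum>p\<in>?P. a (fst p) (snd p) * b (fst p) (snd p)))\<^sup>2 / (?n^2)^2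
     \<le> (\<Sum>p\<in>?P. (norm (a (fst p) (snd p)))\<^sup>2) * (\<Sum>p\<in>?P. (norm (b (fst p) (snd p)))\<^sup>2) / (?n^2)^2"
    by (intro divide_right_mono sum_norm_mult_sq_le) simp
  then show ?thesis
    by (simp add: avg2_eq_sum norm_divide norm_mult power_divide power2_eq_square)
qed

lemma avg2_cong: "(\<And>x y. x \<in> carrier G \<Longrightarrow> y \<in> carrier G \<Longrightarrow> F x y = F' x y) \<Longrightarrow> avg2 F = avg2 F'"
  unfolding avg2_def by (intro avg_cong) auto

lemma avg2_avg: "avg2 (\<lambda>v w. avg (\<lambda>g. H g v w)) = avg (\<lambda>g. avg2 (H g))"
proof -
  have "avg2 (\<lambda>v w. avg (\<lambda>g. H g v w)) = avg (\<lambda>v. avg (\<lambda>g. avg (\<lambda>w. H g v w)))"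
    unfolding avg2_def by (subst (2) avg_swap) (rule refl)
  also have "\<dots> = avg (\<lambda>g. avg2 (H g))"
    unfolding avg2_def by (rule avg_swap)
  finally show ?thesis .
qed

lemma avg2_mult_avg: "avg2 (\<lambda>v w. avg (\<lambda>g. H g v w) * c v w) = avg (\<lambda>g. avg2 (\<lambda>v w. H g v w * c v w))"
  by (simp add: avg2_avg flip: avg_multc)

lemma avg2_mult_avg': "avg2 (\<lambda>v w. c v w * avg (\<lambda>g. H g v w)) = avg (\<lambda>g. avg2 (\<lambda>v w. c v w * H g v w))"
  by (simp add: avg2_avg flip: avg_cmult)

lemma avg2_translate:
  assumes "a \<in> carrier G" "b \<in> carrier G"
  shows "avg2 (\<lambda>v w. F (a \<otimes> v \<otimes> b) (a \<otimes> w \<otimes> b)) = avg2 F"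
proof -
  have *: "avg (\<lambda>v. H (a \<otimes> v \<otimes> b)) = avg H" for H :: "'a \<Rightarrow> 'c"
    using avg_left[OF assms(1), of "\<lambda>v. H (v \<otimes> b)"] avg_right[OF assms(2), of H] by simp
  show ?thesis
    unfolding avg2_def *[of "F _"] by (rule *)
qed

text \<open>With \<open>B(a,b) = \<langle>\<Phi>, L\<^sub>a R\<^sub>b \<Phi>\<rangle>\<close> this is the operator identity \<open>P\<^sup>2 = K P\<close>.\<close>

lemma avg_commutator_identity:
  fixes B :: "'a \<Rightarrow> 'a \<Rightarrow> 'c::real_normed_field"
  shows "avg (\<lambda>g. avg (\<lambda>u. avg (\<lambda>g'. avg (\<lambda>u'.
            B (g' \<otimes> inv g) (inv u \<otimes> inv g \<otimes> u \<otimes> (inv u' \<otimes> g' \<otimes> u'))))))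
       = avg (\<lambda>g. avg (\<lambda>t. avg (\<lambda>m. avg (\<lambda>r.
            B m (g \<otimes> t \<otimes> inv g \<otimes> inv t \<otimes> (inv r \<otimes> m \<otimes> r))))))" (is "?L = ?R")
proof -
  \<comment> \<open>The substitution \<open>g' = m g\<close> isolates \<open>m\<close> as the first
    argument; afterwards \<open>u' = t u\<close> merges the two conjugations by
    \<open>u\<close>.\<close>
  have "?L = avg (\<lambda>g. avg (\<lambda>u. avg (\<lambda>m. avg (\<lambda>u'.
            B m (inv u \<otimes> inv g \<otimes> u \<otimes> (inv u' \<otimes> (m \<otimes> g) \<otimes> u'))))))"
  proof (rule avg_cong, rule avg_cong)
    fix g u assume [simp]: "g \<in> carrier G" "u \<in> carrier G"
    show "avg (\<lambda>g'. avg (\<lambda>u'. B (g' \<otimes> inv g) (inv u \<otimes> inv g \<otimes> u \<otimes> (inv u' \<otimes> g' \<otimes> u'))))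
        = avg (\<lambda>m. avg (\<lambda>u'. B m (inv u \<otimes> inv g \<otimes> u \<otimes> (inv u' \<otimes> (m \<otimes> g) \<otimes> u'))))"
      by (subst avg_right[of g, symmetric]) (auto intro!: avg_cong simp: m_assoc)
  qed
  also have "\<dots> = avg (\<lambda>g. avg (\<lambda>u. avg (\<lambda>m. avg (\<lambda>t.
            B m (inv u \<otimes> inv g \<otimes> inv t \<otimes> m \<otimes> g \<otimes> t \<otimes> u)))))"
  proof (rule avg_cong, rule avg_cong, rule avg_cong)
    fix g u m assume [simp]: "g \<in> carrier G" "u \<in> carrier G" "m \<in> carrier G"
    show "avg (\<lambda>u'. B m (inv u \<otimes> inv g \<otimes> u \<otimes> (inv u' \<otimes> (m \<otimes> g) \<otimes> u')))
        = avg (\<lambda>t. B m (inv u \<otimes> inv g \<otimes> inv t \<otimes> m \<otimes> g \<otimes> t \<otimes> u))"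
      by (subst avg_right[of u, symmetric]) (auto intro!: avg_cong simp: m_assoc inv_mult_group)
  qed
  also have "\<dots> = avg (\<lambda>g. avg (\<lambda>m. avg (\<lambda>t. avg (\<lambda>u.
            B m (inv u \<otimes> inv g \<otimes> inv t \<otimes> m \<otimes> g \<otimes> t \<otimes> u)))))"
    by (subst (2) avg_swap, subst (3) avg_swap) (rule refl)
  \<comment> \<open>Substituting \<open>u = inv t \<otimes> inv g \<otimes> r\<close> turns the
    loose factors around \<open>m\<close> into the commutator of \<open>g\<close> and
    \<open>t\<close>, standing left of \<open>m\<close> inside a conjugation by
    \<open>r\<close>.\<close>
  also have "\<dots> = avg (\<lambda>g. avg (\<lambda>m. avg (\<lambda>t. avg (\<lambda>r.
            B m (inv r \<otimes> g \<otimes> t \<otimes> inv g \<otimes> inv t \<otimes> m \<otimes> r)))))"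
  proof (rule avg_cong, rule avg_cong, rule avg_cong)
    fix g m t assume [simp]: "g \<in> carrier G" "t \<in> carrier G" "m \<in> carrier G"
    show "avg (\<lambda>u. B m (inv u \<otimes> inv g \<otimes> inv t \<otimes> m \<otimes> g \<otimes> t \<otimes> u))
        = avg (\<lambda>r. B m (inv r \<otimes> g \<otimes> t \<otimes> inv g \<otimes> inv t \<otimes> m \<otimes> r))"
      by (subst avg_left[of "inv t \<otimes> inv g", symmetric])
         (auto intro!: avg_cong simp: m_assoc inv_mult_group)
  qed
  also have "\<dots> = avg (\<lambda>m. avg (\<lambda>r. avg (\<lambda>g. avg (\<lambda>t.
            B m (inv r \<otimes> g \<otimes> t \<otimes> inv g \<otimes> inv t \<otimes> m \<otimes> r)))))"
    by (subst avg_swap, subst (3) avg_swap, subst (2) avg_swap) (rule refl)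
  \<comment> \<open>Replacing \<open>g\<close> and \<open>t\<close> by their conjugates under
    \<open>r\<close> carries the outer \<open>inv r\<close> past the commutator, so that only
    \<open>m\<close> remains conjugated.\<close>
  also have "\<dots> = avg (\<lambda>m. avg (\<lambda>r. avg (\<lambda>g. avg (\<lambda>t.
            B m (g \<otimes> t \<otimes> inv g \<otimes> inv t \<otimes> (inv r \<otimes> m \<otimes> r))))))"
  proof (rule avg_cong, rule avg_cong)
    fix m r assume [simp]: "m \<in> carrier G" "r \<in> carrier G"
    let ?H = "\<lambda>g t. B m (inv r \<otimes> g \<otimes> t \<otimes> inv g \<otimes> inv t \<otimes> m \<otimes> r)"
    have "avg (\<lambda>g. avg (\<lambda>t. ?H g t)) = avg (\<lambda>g. avg (\<lambda>t. ?H (r \<otimes> g \<otimes> inv r) (r \<otimes> t \<otimes> inv r)))"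
      by (subst avg_conj[of r, symmetric], simp, subst avg_conj[of r, symmetric], simp_all)
    also have "\<dots> = avg (\<lambda>g. avg (\<lambda>t. B m (g \<otimes> t \<otimes> inv g \<otimes> inv t \<otimes> (inv r \<otimes> m \<otimes> r))))"
      by (auto intro!: avg_cong simp: m_assoc inv_mult_group)
    finally show "avg (\<lambda>g. avg (\<lambda>t. ?H g t))
      = avg (\<lambda>g. avg (\<lambda>t. B m (g \<otimes> t \<otimes> inv g \<otimes> inv t \<otimes> (inv r \<otimes> m \<otimes> r))))" .
  qed
  also have "\<dots> = ?R"
    by (subst (2) avg_swap, subst avg_swap, subst (3) avg_swap, subst (2) avg_swap) (rule refl)
  finally show ?thesis .
qed

section \<open>Reduction to commutator averages\<close>

text \<open>In operator notation this is the inner product of f with its two-sided translate L_a R_b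
  f.\<close>

definition corr :: "('a \<Rightarrow> complex) \<Rightarrow> 'a \<Rightarrow> 'a \<Rightarrow> complex" where
  "corr f a b = avg (\<lambda>v. f v * cnj (f (a \<otimes> v \<otimes> b)))"

text \<open>The operator \<open>K\<close>.\<close>

definition comm_avg :: "('a \<Rightarrow> complex) \<Rightarrow> 'a \<Rightarrow> complex" where
  "comm_avg \<phi> v = avg (\<lambda>k. avg (\<lambda>u. \<phi> (v \<otimes> (k \<otimes> u \<otimes> inv k \<otimes> inv u))))"

text \<open>Passing to the doubled function \<Phi>(v,w) = f(v) cnj(f(w)) makes a squared correlation
  linear in the translation acting on \<Phi>, so averages over translations can be moved inside the
  pairing.\<close>

lemma corr_norm_sq:
  "of_real ((norm (corr f a b))\<^sup>2) =
     avg2 (\<lambda>v w. f v * cnj (f w) * cnj (f (a \<otimes> v \<otimes> b) * cnj (f (a \<otimes> w \<otimes> b))))"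
proof -
  have "of_real ((norm (corr f a b))\<^sup>2) = corr f a b * cnj (corr f a b)"
    by (rule complex_norm_square)
  also have "\<dots> = avg (\<lambda>v. f v * cnj (f (a \<otimes> v \<otimes> b)) * avg (\<lambda>w. cnj (f w * cnj (f (a \<otimes> w \<otimes> b)))))"
    unfolding corr_def cnj_avg by (simp only: avg_multc)
  also have "\<dots> = avg2 (\<lambda>v w. f v * cnj (f w) * cnj (f (a \<otimes> v \<otimes> b) * cnj (f (a \<otimes> w \<otimes> b))))"
    unfolding avg2_def by (simp only: avg_cmult[symmetric]) (simp add: mult_ac)
  finally show ?thesis .
qed

lemma avg2_norm_sq: "of_real (avg2 (\<lambda>v w. (norm (F v w))\<^sup>2)) = avg2 (\<lambda>v w. F v w * cnj (F v w))"
  unfolding avg2_def of_real_avg complex_norm_square ..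

lemma avg2_nonneg: "(\<And>x y. x \<in> carrier G \<Longrightarrow> y \<in> carrier G \<Longrightarrow> 0 \<le> F x y) \<Longrightarrow> 0 \<le> (avg2 F :: real)"
  unfolding avg2_def by (intro avg_nonneg)

text \<open>Here \<Psi> = P \<Phi> and X = K \<Phi>. Since the squared norm of \<Psi> equals the
  pairing of X with \<Psi>, Cauchy--Schwarz gives that \<Psi> is no longer than X; a second
  Cauchy--Schwarz bounds the pairing of \<Phi> with \<Psi>, where the assumption on f makes \<Phi>
  have norm at most 1.\<close>

lemma corr_conj_bound:
  assumes f: "avg (\<lambda>x. (norm (f x))\<^sup>2) \<le> 1"
  shows "(avg2 (\<lambda>g u. (norm (corr f g (inv u \<otimes> g \<otimes> u)))\<^sup>2))\<^sup>2
     \<le> avg2 (\<lambda>s v. (norm (comm_avg (\<lambda>v. f v * cnj (f (s \<otimes> v))) v))\<^sup>2)"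
proof -
  define \<Phi> where "\<Phi> v w = f v * cnj (f w)" for v w
  define C where "C a b = avg2 (\<lambda>v w. \<Phi> v w * cnj (\<Phi> (a \<otimes> v \<otimes> b) (a \<otimes> w \<otimes> b)))" for a b
  define \<Psi> where "\<Psi> v w = avg2 (\<lambda>g u. \<Phi> (g \<otimes> v \<otimes> (inv u \<otimes> g \<otimes> u)) (g \<otimes> w \<otimes> (inv u \<otimes> g \<otimes> u)))" for v w
  define X where "X v w = avg2 (\<lambda>k u. \<Phi> (v \<otimes> (k \<otimes> u \<otimes> inv k \<otimes> inv u)) (w \<otimes> (k \<otimes> u \<otimes> inv k \<otimes> inv u)))" for v w
  let ?nPsi = "avg2 (\<lambda>v w. (norm (\<Psi> v w))\<^sup>2)" and ?nX = "avg2 (\<lambda>v w. (norm (X v w))\<^sup>2)"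
  have Psi_right: "avg2 (\<lambda>v w. \<Phi> v w * cnj (\<Psi> (a \<otimes> v \<otimes> b) (a \<otimes> w \<otimes> b))) =
      avg2 (\<lambda>g u. C (g \<otimes> a) (b \<otimes> (inv u \<otimes> g \<otimes> u)))"
    if [simp]: "a \<in> carrier G" "b \<in> carrier G" for a b
    unfolding C_def \<Psi>_def avg2_def[of "\<lambda>g u. \<Phi> (_ g u) (_ g u)"] cnj_avg avg2_mult_avg'
      avg2_def[of "\<lambda>g u. avg2 (_ g u)"]
    by (intro avg_cong avg2_cong) (simp add: m_assoc)
  have Psi_shift: "avg2 (\<lambda>v w. \<Phi> (a \<otimes> v \<otimes> b) (a \<otimes> w \<otimes> b) * cnj (\<Psi> v w)) =
      avg2 (\<lambda>g u. C (g \<otimes> inv a) (inv b \<otimes> (inv u \<otimes> g \<otimes> u)))"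
    if [simp]: "a \<in> carrier G" "b \<in> carrier G" for a b
  proof -
    \<comment> \<open>The pairing is invariant under simultaneous translation of both arguments, so
      the translation of \<Phi> moves to \<Psi> as its inverse.\<close>
    have "avg2 (\<lambda>v w. \<Phi> (a \<otimes> v \<otimes> b) (a \<otimes> w \<otimes> b) * cnj (\<Psi> v w)) =
        avg2 (\<lambda>v w. \<Phi> (a \<otimes> v \<otimes> b) (a \<otimes> w \<otimes> b) *
          cnj (\<Psi> (inv a \<otimes> (a \<otimes> v \<otimes> b) \<otimes> inv b) (inv a \<otimes> (a \<otimes> w \<otimes> b) \<otimes> inv b)))"
      by (intro avg2_cong) (simp add: m_assoc)
    also have "\<dots> = avg2 (\<lambda>v w. \<Phi> v w * cnj (\<Psi> (inv a \<otimes> v \<otimes> inv b) (inv a \<otimes> w \<otimes> inv b)))"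
      by (rule avg2_translate) auto
    also have "\<dots> = avg2 (\<lambda>g u. C (g \<otimes> inv a) (inv b \<otimes> (inv u \<otimes> g \<otimes> u)))"
      by (rule Psi_right) auto
    finally show ?thesis .
  qed
  have Q: "of_real (avg2 (\<lambda>g u. (norm (corr f g (inv u \<otimes> g \<otimes> u)))\<^sup>2)) = avg2 (\<lambda>v w. \<Phi> v w * cnj (\<Psi> v w))"
  proof -
    have "of_real (avg2 (\<lambda>g u. (norm (corr f g (inv u \<otimes> g \<otimes> u)))\<^sup>2)) = avg2 (\<lambda>g u. C g (inv u \<otimes> g \<otimes> u))"
      unfolding avg2_def[of "\<lambda>g u. _ g u :: real"] of_real_avg corr_norm_sq
      by (simp add: C_def \<Phi>_def avg2_def)
    also have "\<dots> = avg2 (\<lambda>g u. C (g \<otimes> \<one>) (\<one> \<otimes> (inv u \<otimes> g \<otimes> u)))"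
      by (intro avg2_cong) simp
    also have "\<dots> = avg2 (\<lambda>v w. \<Phi> v w * cnj (\<Psi> (\<one> \<otimes> v \<otimes> \<one>) (\<one> \<otimes> w \<otimes> \<one>)))"
      by (rule Psi_right[symmetric]) auto
    also have "\<dots> = avg2 (\<lambda>v w. \<Phi> v w * cnj (\<Psi> v w))"
      by (intro avg2_cong) simp
    finally show ?thesis .
  qed
  have "avg2 (\<lambda>v w. \<Psi> v w * cnj (\<Psi> v w)) = avg2 (\<lambda>v w. X v w * cnj (\<Psi> v w))"
  proof -
    have "avg2 (\<lambda>v w. \<Psi> v w * cnj (\<Psi> v w)) = avg (\<lambda>g. avg (\<lambda>u. avg2 (\<lambda>v w.
        \<Phi> (g \<otimes> v \<otimes> (inv u \<otimes> g \<otimes> u)) (g \<otimes> w \<otimes> (inv u \<otimes> g \<otimes> u)) * cnj (\<Psi> v w))))"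
      by (subst \<Psi>_def) (simp only: avg2_def[of "\<lambda>g u. \<Phi> (_ g u) (_ g u)"] avg2_mult_avg)
    also have "\<dots> = avg (\<lambda>g. avg (\<lambda>u. avg (\<lambda>g'. avg (\<lambda>u'.
            C (g' \<otimes> inv g) (inv u \<otimes> inv g \<otimes> u \<otimes> (inv u' \<otimes> g' \<otimes> u'))))))"
      by (rule avg_cong, rule avg_cong, subst Psi_shift)
         (auto simp: avg2_def inv_mult_group m_assoc intro!: avg_cong)
    also have "\<dots> = avg (\<lambda>g. avg (\<lambda>t. avg (\<lambda>m. avg (\<lambda>r.
            C m (g \<otimes> t \<otimes> inv g \<otimes> inv t \<otimes> (inv r \<otimes> m \<otimes> r))))))"
      by (rule avg_commutator_identity)
    \<comment> \<open>The shift in X enters \<open>Psi_shift\<close> inverted, and the inverse of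
      the commutator of k and u is that of u and k; hence the two outer averages trade
      places.\<close>
    also have "\<dots> = avg (\<lambda>t. avg (\<lambda>g. avg (\<lambda>m. avg (\<lambda>r.
            C m (g \<otimes> t \<otimes> inv g \<otimes> inv t \<otimes> (inv r \<otimes> m \<otimes> r))))))"
      by (rule avg_swap)
    also have "\<dots> = avg (\<lambda>k. avg (\<lambda>u. avg2 (\<lambda>v w.
        \<Phi> (\<one> \<otimes> v \<otimes> (k \<otimes> u \<otimes> inv k \<otimes> inv u)) (\<one> \<otimes> w \<otimes> (k \<otimes> u \<otimes> inv k \<otimes> inv u)) * cnj (\<Psi> v w))))"
      by (rule avg_cong, rule avg_cong, subst Psi_shift)
         (auto simp: avg2_def inv_mult_group m_assoc intro!: avg_cong)
    also have "\<dots> = avg (\<lambda>k. avg (\<lambda>u. avg2 (\<lambda>v w.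
        \<Phi> (v \<otimes> (k \<otimes> u \<otimes> inv k \<otimes> inv u)) (w \<otimes> (k \<otimes> u \<otimes> inv k \<otimes> inv u)) * cnj (\<Psi> v w))))"
      by (intro avg_cong avg2_cong) simp
    also have "\<dots> = avg2 (\<lambda>v w. X v w * cnj (\<Psi> v w))"
      by (subst X_def) (simp only: avg2_def[of "\<lambda>g u. \<Phi> (_ g u) (_ g u)"] avg2_mult_avg)
    finally show ?thesis .
  qed
  then have Psi_X: "of_real ?nPsi = avg2 (\<lambda>v w. X v w * cnj (\<Psi> v w))"
    by (simp add: avg2_norm_sq)
  have nonneg: "0 \<le> ?nPsi" "0 \<le> ?nX" by (intro avg2_nonneg; simp)+
  have "?nPsi ^ 2 = (norm (of_real ?nPsi :: complex))\<^sup>2"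
    by simp
  also have "\<dots> \<le> ?nX * ?nPsi"
    unfolding Psi_X using avg2_cauchy_schwarz[of X "\<lambda>v w. cnj (\<Psi> v w)"] by simp
  finally have "?nPsi * ?nPsi \<le> ?nX * ?nPsi" by (simp add: power2_eq_square)
  then have Psi_le: "?nPsi \<le> ?nX"
    using nonneg by (cases "?nPsi = 0") (auto simp: mult_le_cancel_right)
  have Phi_le: "avg2 (\<lambda>v w. (norm (\<Phi> v w))\<^sup>2) \<le> 1"
  proof -
    have "avg2 (\<lambda>v w. (norm (\<Phi> v w))\<^sup>2) = (avg (\<lambda>x. (norm (f x))\<^sup>2))\<^sup>2"
      by (simp add: avg2_def \<Phi>_def norm_mult power_mult_distrib avg_cmult avg_multc power2_eq_square[of "avg _"])
    also have "\<dots> \<le> 1" using f by (intro power_le_one avg_nonneg) auto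
    finally show ?thesis .
  qed
  have "(avg2 (\<lambda>g u. (norm (corr f g (inv u \<otimes> g \<otimes> u)))\<^sup>2))\<^sup>2
     = (norm (of_real (avg2 (\<lambda>g u. (norm (corr f g (inv u \<otimes> g \<otimes> u)))\<^sup>2)) :: complex))\<^sup>2"
    by simp
  also have "\<dots> \<le> avg2 (\<lambda>v w. (norm (\<Phi> v w))\<^sup>2) * ?nPsi"
    unfolding Q using avg2_cauchy_schwarz[of \<Phi> "\<lambda>v w. cnj (\<Psi> v w)"] by simp
  also have "\<dots> \<le> 1 * ?nX"
    using Phi_le Psi_le nonneg by (intro mult_mono) auto
  \<comment> \<open>With w = s v the right translations act on v alone and fix s, so X splits into
    functions of one variable indexed by s.\<close>
  also have "?nX = avg2 (\<lambda>v s. (norm (X v (s \<otimes> v)))\<^sup>2)"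
    unfolding avg2_def by (rule avg_cong, rule avg_right[symmetric])
  also have "\<dots> = avg2 (\<lambda>s v. (norm (X v (s \<otimes> v)))\<^sup>2)"
    unfolding avg2_def by (rule avg_swap)
  also have "\<dots> = avg2 (\<lambda>s v. (norm (comm_avg (\<lambda>v. f v * cnj (f (s \<otimes> v))) v))\<^sup>2)"
    unfolding X_def comm_avg_def avg2_def \<Phi>_def
    by (intro avg_cong arg_cong[where f = "\<lambda>x. (norm x)\<^sup>2"]) (simp add: m_assoc)
  finally show ?thesis by simp
qed

text \<open>The first Cauchy--Schwarz removes \<open>f1\<close> and the second removes
  \<open>f2\<close>; each squares the average, hence the fourth power. What survives is a
  correlation of f with its translate by a conjugate pair.\<close>

lemma progression_bound:
  fixes f1 f2 f :: "'a \<Rightarrow> complex"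
  assumes f1: "\<And>x. x \<in> carrier G \<Longrightarrow> norm (f1 x) \<le> 1"
    and f2: "\<And>x. x \<in> carrier G \<Longrightarrow> norm (f2 x) \<le> 1"
  shows "(norm (avg2 (\<lambda>x y. f1 x * f2 (x \<otimes> y) * f (x \<otimes> (y \<otimes> y))))) ^ 4
    \<le> avg2 (\<lambda>g u. (norm (corr f g (inv u \<otimes> g \<otimes> u)))\<^sup>2)"
proof -
  define Y where "Y x = avg (\<lambda>y. f2 (x \<otimes> y) * f (x \<otimes> (y \<otimes> y)))" for x
  let ?S = "avg (\<lambda>x. (norm (Y x))\<^sup>2)"
  have sq: "(norm z)\<^sup>2 \<le> 1" if "norm z \<le> 1" for z :: complex
    using that by (simp add: power_le_one)
  have "avg2 (\<lambda>x y. f1 x * f2 (x \<otimes> y) * f (x \<otimes> (y \<otimes> y))) = avg (\<lambda>x. f1 x * Y x)"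
    unfolding Y_def avg2_def by (simp add: mult.assoc flip: avg_cmult)
  then have "(norm (avg2 (\<lambda>x y. f1 x * f2 (x \<otimes> y) * f (x \<otimes> (y \<otimes> y)))))\<^sup>2
      \<le> avg (\<lambda>x. (norm (f1 x))\<^sup>2) * ?S"
    using avg_cauchy_schwarz[of f1 Y] by simp
  also have "\<dots> \<le> avg (\<lambda>x. 1) * ?S"
    by (intro mult_right_mono avg_mono avg_nonneg) (auto simp: sq f1)
  finally have first: "(norm (avg2 (\<lambda>x y. f1 x * f2 (x \<otimes> y) * f (x \<otimes> (y \<otimes> y)))))\<^sup>2 \<le> ?S"
    by simp
  define H where "H x y z = f2 (x \<otimes> y) * f (x \<otimes> (y \<otimes> y)) * cnj (f2 (x \<otimes> z) * f (x \<otimes> (z \<otimes> z)))" for x y z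
  have "of_real ?S = avg (\<lambda>x. Y x * cnj (Y x))"
    by (simp only: of_real_avg complex_norm_square)
  also have "\<dots> = avg (\<lambda>x. avg (\<lambda>y. avg (\<lambda>z. H x y z)))"
    unfolding Y_def cnj_avg H_def avg_multc[symmetric] by (simp only: avg_cmult[symmetric])
  also have "\<dots> = avg (\<lambda>y. avg (\<lambda>z. avg (\<lambda>x. H x y z)))"
    by (subst avg_swap, subst (2) avg_swap) (rule refl)
  \<comment> \<open>The substitutions \<open>x = u \<otimes> inv y\<close>,
    \<open>z = y \<otimes> h\<close> and \<open>y = inv u \<otimes> v\<close> free the
    \<open>f2\<close> factors of v and turn the arguments of f into \<open>v\<close> and
    \<open>u \<otimes> h \<otimes> inv u \<otimes> v \<otimes> h\<close>.\<close>
  also have "\<dots> = avg (\<lambda>y. avg (\<lambda>z. avg (\<lambda>u. H (u \<otimes> inv y) y z)))"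
    by (rule avg_cong, rule avg_cong, rule avg_right[symmetric]) simp
  also have "\<dots> = avg (\<lambda>y. avg (\<lambda>h. avg (\<lambda>u. H (u \<otimes> inv y) y (y \<otimes> h))))"
    by (rule avg_cong, rule avg_left[symmetric])
  also have "\<dots> = avg (\<lambda>u. avg (\<lambda>h. avg (\<lambda>y. H (u \<otimes> inv y) y (y \<otimes> h))))"
    by (subst (2) avg_swap, subst avg_swap, subst (2) avg_swap) (rule refl)
  also have "\<dots> = avg (\<lambda>u. avg (\<lambda>h. avg (\<lambda>v. H (u \<otimes> inv (inv u \<otimes> v)) (inv u \<otimes> v) (inv u \<otimes> v \<otimes> h))))"
    by (rule avg_cong, rule avg_cong, rule avg_left[symmetric]) simp
  also have "\<dots> = avg (\<lambda>u. avg (\<lambda>h. avg (\<lambda>v. f2 u * cnj (f2 (u \<otimes> h)) *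
        (f v * cnj (f (u \<otimes> h \<otimes> inv u \<otimes> v \<otimes> h))))))"
    by (intro avg_cong) (simp add: H_def m_assoc inv_mult_group mult_ac)
  also have "\<dots> = avg2 (\<lambda>u h. f2 u * cnj (f2 (u \<otimes> h)) * corr f (u \<otimes> h \<otimes> inv u) h)"
    unfolding avg2_def corr_def avg_cmult ..
  finally have S: "of_real ?S = avg2 (\<lambda>u h. f2 u * cnj (f2 (u \<otimes> h)) * corr f (u \<otimes> h \<otimes> inv u) h)" .
  have "?S ^ 2 = (norm (of_real ?S :: complex))\<^sup>2"
    by simp
  also have "\<dots> \<le> avg2 (\<lambda>u h. (norm (f2 u * cnj (f2 (u \<otimes> h))))\<^sup>2) *
      avg2 (\<lambda>u h. (norm (corr f (u \<otimes> h \<otimes> inv u) h))\<^sup>2)"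
    unfolding S by (rule avg2_cauchy_schwarz)
  also have "\<dots> \<le> avg2 (\<lambda>u h. 1) * avg2 (\<lambda>u h. (norm (corr f (u \<otimes> h \<otimes> inv u) h))\<^sup>2)"
    unfolding avg2_def
    by (intro mult_right_mono avg_mono avg_nonneg) (auto simp: norm_mult intro!: power_le_one mult_le_one f2)
  also have "\<dots> = avg (\<lambda>u. avg (\<lambda>h. (norm (corr f (u \<otimes> h \<otimes> inv u) h))\<^sup>2))"
    by (simp add: avg2_def)
  \<comment> \<open>Writing \<open>h\<close> as a conjugate of \<open>g\<close> by \<open>u\<close>
    gives the parametrisation of conjugate pairs used in \<open>corr_conj_bound\<close>.\<close>
  also have "\<dots> = avg (\<lambda>u. avg (\<lambda>g. (norm (corr f (u \<otimes> (inv u \<otimes> g \<otimes> u) \<otimes> inv u) (inv u \<otimes> g \<otimes> u)))\<^sup>2))"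
    by (rule avg_cong, subst avg_conj[symmetric, of "inv _"]) auto
  also have "\<dots> = avg (\<lambda>u. avg (\<lambda>g. (norm (corr f g (inv u \<otimes> g \<otimes> u)))\<^sup>2))"
    by (intro avg_cong) (simp add: m_assoc)
  also have "\<dots> = avg2 (\<lambda>g u. (norm (corr f g (inv u \<otimes> g \<otimes> u)))\<^sup>2)"
    unfolding avg2_def by (rule avg_swap)
  finally have second: "?S ^ 2 \<le> avg2 (\<lambda>g u. (norm (corr f g (inv u \<otimes> g \<otimes> u)))\<^sup>2)" .
  have "(norm (avg2 (\<lambda>x y. f1 x * f2 (x \<otimes> y) * f (x \<otimes> (y \<otimes> y))))) ^ 4
      = ((norm (avg2 (\<lambda>x y. f1 x * f2 (x \<otimes> y) * f (x \<otimes> (y \<otimes> y)))))\<^sup>2)\<^sup>2"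
    by simp
  also have "\<dots> \<le> ?S ^ 2"
    by (rule power_mono[OF first]) simp
  finally show ?thesis using second by simp
qed

section \<open>Schur orthogonality\<close>

context
  fixes d :: nat and \<rho>
  assumes rep: "is_rep G d \<rho>"
begin

lemma rep_carrier: "g \<in> carrier G \<Longrightarrow> \<rho> g \<in> carrier_mat d d"
  using rep by (auto simp: is_rep_def hom_def GL_carrier)

lemma rep_mult: "g \<in> carrier G \<Longrightarrow> h \<in> carrier G \<Longrightarrow> \<rho> (g \<otimes> h) = \<rho> g * \<rho> h"
  using rep by (auto simp: is_rep_def hom_def GL_mult)

lemma rep_one: "\<rho> \<one> = 1\<^sub>m d"
  using hom_one[of \<rho> G "GL d"] rep GL_group is_group by (simp add: is_rep_def GL_one)

lemma rep_mult_index: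
  assumes "g \<in> carrier G" "h \<in> carrier G" "i < d" "j < d"
  shows "\<rho> (g \<otimes> h) $$ (i, j) = (\<Sum>k<d. \<rho> g $$ (i, k) * \<rho> h $$ (k, j))"
  using assms rep_carrier[of g] rep_carrier[of h]
  by (auto simp: rep_mult scalar_prod_def atLeast0LessThan intro!: sum.cong)

end

text \<open>Over the complex numbers M has an eigenvalue because d is positive. Its eigenspace is
  nonzero and, as M commutes with the action, invariant; irreducibility makes it the whole
  space.\<close>

lemma schur:
  assumes irr: "irreducible_rep G d \<rho>" and M: "M \<in> carrier_mat d d"
    and comm: "\<And>g. g \<in> carrier G \<Longrightarrow> \<rho> g * M = M * \<rho> g"
  obtains c where "M = c \<cdot>\<^sub>m 1\<^sub>m d"
proof -
  have rep: "is_rep G d \<rho>" and d: "d > 0" using irr by (auto simp: irreducible_rep_def)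
  obtain c where "eigenvalue M c"
    using spectrum_non_empty[OF M d] by (auto simp: spectrum_def)
  then obtain v where v: "v \<in> carrier_vec d" "v \<noteq> 0\<^sub>v d" "M *\<^sub>v v = c \<cdot>\<^sub>v v"
    using M by (auto simp: eigenvalue_def eigenvector_def)
  define W where "W = {w \<in> carrier_vec d. M *\<^sub>v w = c \<cdot>\<^sub>v w}"
  have "invariant_subspace G d \<rho> W"
  proof (rule invariant_subspaceI)
    fix g w assume g: "g \<in> carrier G" and w: "w \<in> W"
    then have w': "w \<in> carrier_vec d" "M *\<^sub>v w = c \<cdot>\<^sub>v w" by (auto simp: W_def)
    have \<rho>: "\<rho> g \<in> carrier_mat d d" by (rule rep_carrier[OF rep g])
    have "M *\<^sub>v (\<rho> g *\<^sub>v w) = (M * \<rho> g) *\<^sub>v w"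
      using M \<rho> w' by simp
    also have "\<dots> = \<rho> g *\<^sub>v (M *\<^sub>v w)"
      using M \<rho> w' by (simp flip: comm[OF g])
    also have "\<dots> = c \<cdot>\<^sub>v (\<rho> g *\<^sub>v w)"
      using \<rho> w' by (simp add: mult_mat_vec)
    finally show "\<rho> g *\<^sub>v w \<in> W" using \<rho> w' by (simp add: W_def)
  qed (use M in \<open>auto simp: W_def mult_add_distrib_mat_vec mult_mat_vec smult_add_distrib_vec smult_smult_assoc mult.commute\<close>)
  moreover have "W \<noteq> {0\<^sub>v d}" using v by (auto simp: W_def)
  ultimately have W: "W = carrier_vec d" using irr by (auto simp: irreducible_rep_def)
  have "M = c \<cdot>\<^sub>m 1\<^sub>m d"
  proof (rule eq_matI)
    fix i j assume ij: "i < dim_row (c \<cdot>\<^sub>m 1\<^sub>m d)" "j < dim_col (c \<cdot>\<^sub>m 1\<^sub>m d)"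
    then have "unit_vec d j \<in> W" using W by simp
    then have "M *\<^sub>v unit_vec d j = c \<cdot>\<^sub>v unit_vec d j" by (simp add: W_def)
    then have "(M *\<^sub>v unit_vec d j) $ i = (c \<cdot>\<^sub>v unit_vec d j) $ i" by simp
    then show "M $$ (i, j) = (c \<cdot>\<^sub>m 1\<^sub>m d) $$ (i, j)" using M ij by (auto split: if_splits)
  qed (use M in auto)
  then show ?thesis by (rule that)
qed

text \<open>For fixed i and j these are the entries of the average of \<rho>(u) E_ij \<rho>(u)^-1,
  with E_ij a matrix unit. This average commutes with \<rho>, so it is scalar by
  \<open>schur\<close>. Writing \<open>inv u\<close> instead of a conjugate transpose keeps the
  statement valid for every irreducible matrix representation, unitary or not.\<close>

lemma schur_orthogonality:
  assumes irr: "irreducible_rep G d \<rho>" and idx: "a < d" "i < d" "j < d" "b < d"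
  shows "avg (\<lambda>u. \<rho> u $$ (a, i) * \<rho> (inv u) $$ (j, b)) = (if a = b \<and> i = j then 1 / of_nat d else 0)"
proof -
  have rep: "is_rep G d \<rho>" using irr by (simp add: irreducible_rep_def)
  define m where "m a b = avg (\<lambda>u. \<rho> u $$ (a, i) * \<rho> (inv u) $$ (j, b))" for a b
  define M where "M = mat d d (\<lambda>(a, b). m a b)"
  have M: "M \<in> carrier_mat d d" by (simp add: M_def)
  have comm: "\<rho> g * M = M * \<rho> g" if g: "g \<in> carrier G" for g
  proof (rule eq_matI)
    fix a b assume "a < dim_row (M * \<rho> g)" "b < dim_col (M * \<rho> g)"
    then have ab: "a < d" "b < d" using M rep_carrier[OF rep g] by auto
    have "(\<rho> g * M) $$ (a, b) = (\<Sum>k<d. \<rho> g $$ (a, k) * m k b)"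
      using ab M rep_carrier[OF rep g]
      by (auto simp: scalar_prod_def atLeast0LessThan M_def intro!: sum.cong)
    also have "\<dots> = avg (\<lambda>u. (\<Sum>k<d. \<rho> g $$ (a, k) * \<rho> u $$ (k, i)) * \<rho> (inv u) $$ (j, b))"
      by (simp add: m_def avg_sum avg_cmult sum_distrib_right mult.assoc)
    also have "\<dots> = avg (\<lambda>u. \<rho> (g \<otimes> u) $$ (a, i) * \<rho> (inv u) $$ (j, b))"
      using ab idx g by (intro avg_cong) (simp add: rep_mult_index[OF rep])
    also have "\<dots> = avg (\<lambda>u. \<rho> (g \<otimes> u) $$ (a, i) * \<rho> (inv (g \<otimes> u) \<otimes> g) $$ (j, b))"
      using g by (intro avg_cong) (simp add: inv_mult_group m_assoc)
    also have "\<dots> = avg (\<lambda>u. \<rho> u $$ (a, i) * \<rho> (inv u \<otimes> g) $$ (j, b))"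
      by (rule avg_left[OF g])
    also have "\<dots> = avg (\<lambda>u. \<rho> u $$ (a, i) * (\<Sum>k<d. \<rho> (inv u) $$ (j, k) * \<rho> g $$ (k, b)))"
      using ab idx g by (intro avg_cong) (simp add: rep_mult_index[OF rep])
    also have "\<dots> = (\<Sum>k<d. m a k * \<rho> g $$ (k, b))"
      by (simp add: m_def avg_sum sum_distrib_left mult.assoc flip: avg_multc)
    also have "\<dots> = (M * \<rho> g) $$ (a, b)"
      using ab M rep_carrier[OF rep g]
      by (auto simp: scalar_prod_def atLeast0LessThan M_def intro!: sum.cong)
    finally show "(\<rho> g * M) $$ (a, b) = (M * \<rho> g) $$ (a, b)" .
  qed (use M rep_carrier[OF rep g] in auto)
  obtain c where c: "M = c \<cdot>\<^sub>m 1\<^sub>m d" using schur[OF irr M comm] by blast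
  have m: "m a b = (if a = b then c else 0)" if "a < d" "b < d" for a b
  proof -
    have "m a b = M $$ (a, b)" using that by (simp add: M_def)
    then show ?thesis using that by (simp add: c)
  qed
  \<comment> \<open>The trace fixes the scalar: cyclic reordering of the product leaves the (j,i)
    entry of \<rho>(\<open>inv u \<otimes> u\<close>), an entry of the identity matrix.\<close>
  have "of_nat d * c = (\<Sum>k<d. m k k)" by (simp add: m)
  also have "\<dots> = avg (\<lambda>u. \<Sum>k<d. \<rho> (inv u) $$ (j, k) * \<rho> u $$ (k, i))"
    by (simp add: m_def avg_sum mult.commute)
  also have "\<dots> = avg (\<lambda>u. \<rho> (inv u \<otimes> u) $$ (j, i))"
    using idx by (intro avg_cong, subst rep_mult_index[OF rep]) auto
  also have "\<dots> = avg (\<lambda>u. if i = j then 1 else 0)"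
    using idx by (intro avg_cong) (simp add: rep_one[OF rep])
  finally have "of_nat d * c = (if i = j then 1 else 0)" by simp
  then have "c = (if i = j then 1 / of_nat d else 0)"
    using idx by (auto simp: field_simps split: if_splits)
  then show ?thesis using m[of a b] idx by (simp add: m_def)
qed

text \<open>Orthogonality is applied twice, first in u and then in k, and each application
  contributes a factor 1/d. The average over u contracts indices into the trace of
  \<rho>(\<open>inv k\<close>), of which the average over k keeps a single diagonal term.\<close>

lemma commutator_average:
  assumes irr: "irreducible_rep G d \<rho>" and idx: "a < d" "b < d"
  shows "avg (\<lambda>k. avg (\<lambda>u. \<rho> (k \<otimes> u \<otimes> inv k \<otimes> inv u) $$ (a, b))) = (if a = b then 1 / (of_nat d)\<^sup>2 else 0)"
proof -
  have rep: "is_rep G d \<rho>" using irr by (simp add: irreducible_rep_def)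
  have "avg (\<lambda>k. avg (\<lambda>u. \<rho> (k \<otimes> u \<otimes> inv k \<otimes> inv u) $$ (a, b)))
    = avg (\<lambda>k. avg (\<lambda>u. \<Sum>r<d. (\<Sum>q<d. (\<Sum>p<d. \<rho> k $$ (a, p) * \<rho> u $$ (p, q)) * \<rho> (inv k) $$ (q, r)) * \<rho> (inv u) $$ (r, b)))"
    using idx by (intro avg_cong) (simp add: rep_mult_index[OF rep])
  also have "\<dots> = avg (\<lambda>k. \<Sum>r<d. \<Sum>q<d. \<Sum>p<d. \<rho> k $$ (a, p) * \<rho> (inv k) $$ (q, r) *
      avg (\<lambda>u. \<rho> u $$ (p, q) * \<rho> (inv u) $$ (r, b)))"
    by (rule avg_cong) (simp add: sum_distrib_left sum_distrib_right avg_sum mult_ac flip: avg_cmult)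
  also have "\<dots> = avg (\<lambda>k. \<Sum>r<d. \<Sum>q<d. \<Sum>p<d. if p = b then if q = r then \<rho> k $$ (a, p) * \<rho> (inv k) $$ (q, r) / of_nat d else 0 else 0)"
    using idx by (intro avg_cong sum.cong refl) (simp add: schur_orthogonality[OF irr])
  also have "\<dots> = avg (\<lambda>k. \<Sum>r<d. \<rho> k $$ (a, b) * \<rho> (inv k) $$ (r, r) / of_nat d)"
    using idx by (simp add: sum.delta)
  also have "\<dots> = (\<Sum>r<d. avg (\<lambda>k. \<rho> k $$ (a, b) * \<rho> (inv k) $$ (r, r)) / of_nat d)"
    by (simp add: avg_sum divide_inverse avg_multc)
  also have "\<dots> = (\<Sum>r<d. if r = b then if a = b then 1 / (of_nat d)\<^sup>2 else 0 else 0)"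
    using idx by (intro sum.cong refl) (auto simp: schur_orthogonality[OF irr] power2_eq_square)
  also have "\<dots> = (if a = b then 1 / (of_nat d)\<^sup>2 else 0)"
    using idx by (simp add: sum.delta)
  finally show ?thesis .
qed

section \<open>Invariant spaces of functions\<close>

text \<open>Functions are normalised to vanish off the carrier, so that agreement on \<open>G\<close> is equality in HOL.\<close>

definition supported :: "('a \<Rightarrow> complex) set" where
  "supported = {f. \<forall>x. x \<notin> carrier G \<longrightarrow> f x = 0}"

definition rtrans :: "'a \<Rightarrow> ('a \<Rightarrow> complex) \<Rightarrow> 'a \<Rightarrow> complex" where
  "rtrans g f = (\<lambda>x. if x \<in> carrier G then f (x \<otimes> g) else 0)"

definition ip :: "('a \<Rightarrow> complex) \<Rightarrow> ('a \<Rightarrow> complex) \<Rightarrow> complex" where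
  "ip a b = avg (\<lambda>x. a x * cnj (b x))"

definition norm_sq :: "('a \<Rightarrow> complex) \<Rightarrow> real" where
  "norm_sq f = avg (\<lambda>x. (norm (f x))\<^sup>2)"

definition invariant_space :: "('a \<Rightarrow> complex) set \<Rightarrow> bool" where
  "invariant_space W \<longleftrightarrow> W \<subseteq> supported \<and> (\<lambda>x. 0) \<in> W \<and>
     (\<forall>f\<in>W. \<forall>h\<in>W. (\<lambda>x. f x + h x) \<in> W) \<and> (\<forall>c. \<forall>f\<in>W. (\<lambda>x. c * f x) \<in> W) \<and>
     (\<forall>g\<in>carrier G. \<forall>f\<in>W. rtrans g f \<in> W)"

definition orthonormal :: "('a \<Rightarrow> complex) set \<Rightarrow> nat \<Rightarrow> (nat \<Rightarrow> 'a \<Rightarrow> complex) \<Rightarrow> bool" where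
  "orthonormal W d b \<longleftrightarrow> (\<forall>i<d. b i \<in> W) \<and> (\<forall>i<d. \<forall>j<d. ip (b i) (b j) = (if i = j then 1 else 0))"

text \<open>For an invariant space this is its dimension; the maximum exists because Bessel's inequality
  bounds orthonormal families by the order of \<open>G\<close>.\<close>

definition max_orthonormal :: "('a \<Rightarrow> complex) set \<Rightarrow> nat" where
  "max_orthonormal W = (GREATEST d. \<exists>b. orthonormal W d b)"

section \<open>Inner product and right translations\<close>

lemma ip_add_left: "ip (\<lambda>x. a x + b x) c = ip a c + ip b c"
  by (simp add: ip_def distrib_right avg_add)

lemma ip_add_right: "ip c (\<lambda>x. a x + b x) = ip c a + ip c b"
  by (simp add: ip_def distrib_left avg_add)

lemma ip_diff_left: "ip (\<lambda>x. a x - b x) c = ip a c - ip b c"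
  by (simp add: ip_def left_diff_distrib avg_diff)

lemma ip_cmult_left: "ip (\<lambda>x. k * a x) c = k * ip a c"
  by (simp add: ip_def mult.assoc avg_cmult)

lemma ip_cmult_right: "ip a (\<lambda>x. k * c x) = cnj k * ip a c"
  by (simp add: ip_def mult_ac flip: avg_cmult)

lemma ip_sum_left: "ip (\<lambda>x. \<Sum>i\<in>I. a i * b i x) c = (\<Sum>i\<in>I. a i * ip (b i) c)"
  by (simp add: ip_def sum_distrib_right avg_sum mult.assoc avg_cmult)

lemma ip_sum_right: "ip c (\<lambda>x. \<Sum>i\<in>I. a i * b i x) = (\<Sum>i\<in>I. cnj (a i) * ip c (b i))"
  by (simp add: ip_def sum_distrib_left avg_sum mult_ac flip: avg_cmult)

lemma cnj_ip: "cnj (ip a b) = ip b a"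
  by (simp add: ip_def cnj_avg mult.commute)

lemma ip_zero_sym: "ip a b = 0 \<Longrightarrow> ip b a = 0"
  using cnj_ip[of a b] by simp

lemma ip_self: "ip f f = of_real (norm_sq f)"
  unfolding ip_def norm_sq_def of_real_avg complex_norm_square ..

lemma norm_sq_nonneg: "0 \<le> norm_sq f"
  unfolding norm_sq_def by (rule avg_nonneg) simp

lemma norm_sq_eq_0:
  assumes "f \<in> supported" "norm_sq f = 0"
  shows "f = (\<lambda>x. 0)"
proof
  fix x
  have "(\<Sum>x\<in>carrier G. (norm (f x))\<^sup>2) = 0"
    using assms(2) card_pos by (simp add: norm_sq_def avg_def)
  then have "\<forall>x\<in>carrier G. (norm (f x))\<^sup>2 = 0"
    by (subst (asm) sum_nonneg_eq_0_iff) (auto simp: fin)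
  then show "f x = 0" using assms(1) by (cases "x \<in> carrier G") (auto simp: supported_def)
qed

lemma norm_sq_orthogonal_add: "ip a b = 0 \<Longrightarrow> norm_sq (\<lambda>x. a x + b x) = norm_sq a + norm_sq b"
proof -
  assume "ip a b = 0"
  then have "of_real (norm_sq (\<lambda>x. a x + b x)) = (of_real (norm_sq a + norm_sq b) :: complex)"
    by (simp add: ip_add_left ip_add_right ip_zero_sym flip: ip_self)
  then show ?thesis using of_real_eq_iff by blast
qed

lemma rtrans_supported: "rtrans g f \<in> supported"
  by (simp add: rtrans_def supported_def)

lemma rtrans_one: "f \<in> supported \<Longrightarrow> rtrans \<one> f = f"
  by (auto simp: rtrans_def supported_def)

lemma rtrans_mult: "g \<in> carrier G \<Longrightarrow> h \<in> carrier G \<Longrightarrow> rtrans (g \<otimes> h) f = rtrans g (rtrans h f)"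
  by (auto simp: rtrans_def m_assoc)

lemma rtrans_add: "rtrans g (\<lambda>x. a x + b x) = (\<lambda>x. rtrans g a x + rtrans g b x)"
  by (auto simp: rtrans_def)

lemma rtrans_sum: "rtrans g (\<lambda>x. \<Sum>i\<in>I. c i * b i x) = (\<lambda>x. \<Sum>i\<in>I. c i * rtrans g (b i) x)"
  by (auto simp: rtrans_def)

lemma ip_rtrans_left: 
  assumes [simp]: "g \<in> carrier G" shows "ip (rtrans g a) b = ip a (rtrans (inv g) b)"
  unfolding ip_def using avg_right[of "inv g" "\<lambda>x. rtrans g a x * cnj (b x)"]
  by (simp add: rtrans_def m_assoc cong: avg_cong)

lemma invariant_space_sum:
  assumes W: "invariant_space W" and "\<And>i. i \<in> I \<Longrightarrow> f i \<in> W"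
  shows "(\<lambda>x. \<Sum>i\<in>I. c i * f i x) \<in> W"
  using assms(2)
proof (induction I rule: infinite_finite_induct)
  case (insert i I)
  then have "(\<lambda>x. c i * f i x) \<in> W" "(\<lambda>x. \<Sum>i\<in>I. c i * f i x) \<in> W"
    using W by (auto simp: invariant_space_def)
  then have "(\<lambda>x. c i * f i x + (\<Sum>i\<in>I. c i * f i x)) \<in> W"
    using W by (auto simp: invariant_space_def)
  then show ?case using insert by simp
qed (use W in \<open>auto simp: invariant_space_def\<close>)

lemma invariant_space_add: "invariant_space W \<Longrightarrow> f \<in> W \<Longrightarrow> h \<in> W \<Longrightarrow> (\<lambda>x. f x + h x) \<in> W"
  by (simp add: invariant_space_def)

lemma invariant_space_cmult: "invariant_space W \<Longrightarrow> f \<in> W \<Longrightarrow> (\<lambda>x. c * f x) \<in> W"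
  by (simp add: invariant_space_def)

lemma invariant_space_diff:
  assumes "invariant_space W" "f \<in> W" "h \<in> W"
  shows "(\<lambda>x. f x - h x) \<in> W"
  using invariant_space_add[OF assms(1,2) invariant_space_cmult[OF assms(1,3), of "-1"]] by simp

section \<open>Orthogonal projection, Bessel's inequality and dimension\<close>

definition proj :: "nat \<Rightarrow> (nat \<Rightarrow> 'a \<Rightarrow> complex) \<Rightarrow> ('a \<Rightarrow> complex) \<Rightarrow> 'a \<Rightarrow> complex" where
  "proj d b f = (\<lambda>x. \<Sum>i<d. ip f (b i) * b i x)"

lemma orthonormal_ip_sum:
  assumes "orthonormal W d b" "j < d"
  shows "ip (\<lambda>x. \<Sum>i<d. c i * b i x) (b j) = c j"
  using assms by (simp add: ip_sum_left orthonormal_def if_distrib[where f = "\<lambda>x. _ * x"] sum.delta cong: if_cong)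

lemma proj_orthogonal:
  assumes "orthonormal W d b" "j < d"
  shows "ip (\<lambda>x. f x - proj d b f x) (b j) = 0"
  using orthonormal_ip_sum[OF assms] by (simp add: ip_diff_left proj_def)

lemma norm_sq_sum:
  assumes "orthonormal W d b"
  shows "norm_sq (\<lambda>x. \<Sum>i<d. c i * b i x) = (\<Sum>i<d. (norm (c i))\<^sup>2)"
proof -
  have "of_real (norm_sq (\<lambda>x. \<Sum>i<d. c i * b i x)) = (\<Sum>i<d. cnj (c i) * c i)"
    using orthonormal_ip_sum[OF assms] by (simp add: ip_sum_right flip: ip_self)
  also have "\<dots> = of_real (\<Sum>i<d. (norm (c i))\<^sup>2)"
    by (simp add: mult.commute of_real_sum complex_norm_square del: of_real_power)
  finally show ?thesis using of_real_eq_iff by blast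
qed

lemma bessel:
  assumes "orthonormal W d b"
  shows "(\<Sum>i<d. (norm (ip f (b i)))\<^sup>2) \<le> norm_sq f"
proof -
  let ?r = "\<lambda>x. f x - proj d b f x"
  have "ip ?r (proj d b f) = 0"
    using proj_orthogonal[OF assms] by (subst (2) proj_def) (simp add: ip_sum_right)
  then have "norm_sq (\<lambda>x. ?r x + proj d b f x) = norm_sq ?r + norm_sq (proj d b f)"
    by (rule norm_sq_orthogonal_add)
  moreover have "norm_sq (proj d b f) = (\<Sum>i<d. (norm (ip f (b i)))\<^sup>2)"
    unfolding proj_def by (rule norm_sq_sum[OF assms])
  ultimately show ?thesis using norm_sq_nonneg[of ?r] by simp
qed

lemma avg_delta:
  assumes "y \<in> carrier G"
  shows "avg (\<lambda>x. if x = y then c else 0) = c / of_nat (card (carrier G))"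
  using assms fin by (simp add: avg_def)

text \<open>Bessel's inequality for a point mass at y bounds the sum of the squared moduli of the
  b_i(y) by the order of G. Averaging over y turns that sum into d, since each b_i has norm
  1.\<close>

lemma orthonormal_bound:
  assumes "orthonormal W d b"
  shows "d \<le> card (carrier G)"
proof -
  let ?n = "real (card (carrier G))"
  have pt: "(\<Sum>i<d. (norm (b i y))\<^sup>2) \<le> ?n" if y: "y \<in> carrier G" for y
  proof -
    \<comment> \<open>The height is the order of G because the inner product is an average; pairing
      with \<open>?\<delta>\<close> is then exact evaluation at y.\<close>
    let ?\<delta> = "\<lambda>x. if x = y then of_nat (card (carrier G)) else 0 :: complex"
    have "ip ?\<delta> (b i) = avg (\<lambda>x. if x = y then of_nat (card (carrier G)) * cnj (b i y) else 0)" for i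
      unfolding ip_def by (rule avg_cong) auto
    then have "ip ?\<delta> (b i) = cnj (b i y)" for i
      using card_pos by (simp add: avg_delta y)
    moreover have "norm_sq ?\<delta> = avg (\<lambda>x. if x = y then ?n * ?n else 0)"
      unfolding norm_sq_def by (rule avg_cong) (auto simp: power2_eq_square)
    then have "norm_sq ?\<delta> = ?n"
      using card_pos by (simp add: avg_delta y)
    ultimately show ?thesis using bessel[OF assms, of ?\<delta>] by simp
  qed
  have "norm_sq (b i) = 1" if "i < d" for i
  proof -
    have "of_real (norm_sq (b i)) = (1 :: complex)"
      using assms that by (simp add: orthonormal_def flip: ip_self)
    then show ?thesis using of_real_eq_1_iff by blast
  qed
  then have "real d = (\<Sum>i<d. norm_sq (b i))" by simp
  also have "\<dots> = avg (\<lambda>y. \<Sum>i<d. (norm (b i y))\<^sup>2)"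
    by (simp add: norm_sq_def avg_sum)
  also have "\<dots> \<le> avg (\<lambda>y. ?n)" by (rule avg_mono[OF pt])
  finally show ?thesis by simp
qed

lemma max_orthonormal_ge: "orthonormal W d b \<Longrightarrow> d \<le> max_orthonormal W"
  unfolding max_orthonormal_def
  by (rule Greatest_le_nat[where b = "card (carrier G)"], blast, use orthonormal_bound in blast)

lemma max_orthonormal_basis: "\<exists>b. orthonormal W (max_orthonormal W) b"
  unfolding max_orthonormal_def
  by (rule GreatestI_nat[where k = 0 and b = "card (carrier G)"], simp add: orthonormal_def, use orthonormal_bound in blast)

lemma orthonormal_extend:
  assumes "invariant_space W" "orthonormal W d b" "r \<in> W" "r \<noteq> (\<lambda>x. 0)" and ort: "\<And>j. j < d \<Longrightarrow> ip r (b j) = 0"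
  shows "\<exists>b'. orthonormal W (Suc d) b'"
proof -
  have r: "norm_sq r > 0"
  proof -
    have "r \<in> supported" using assms(1,3) unfolding invariant_space_def by blast
    then have "norm_sq r \<noteq> 0" using assms(4) norm_sq_eq_0 by blast
    then show ?thesis using norm_sq_nonneg[of r] by simp
  qed
  define e where "e = (\<lambda>x. of_real (1 / sqrt (norm_sq r)) * r x)"
  have e: "e \<in> W" unfolding e_def by (rule invariant_space_cmult[OF assms(1,3)])
  have "ip e e = 1"
    unfolding e_def ip_cmult_left ip_cmult_right ip_self using r
    by (simp flip: of_real_mult add: field_simps)
  moreover have "ip e (b j) = 0" "ip (b j) e = 0" if "j < d" for j
    using ort[OF that] ip_zero_sym[OF ort[OF that]] unfolding e_def ip_cmult_left ip_cmult_right
    by simp_all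
  ultimately have "orthonormal W (Suc d) (b(d := e))"
    using assms(2) e by (auto simp: orthonormal_def less_Suc_eq)
  then show ?thesis by blast
qed

text \<open>A nonzero residual would enlarge the family beyond the maximum. The inequality on d lets
  the family come from a smaller invariant space already known to have at least as large a maximum,
  as happens in the irreducibility argument below.\<close>

lemma proj_max_orthonormal:
  assumes W: "invariant_space W" and b: "orthonormal W d b" "max_orthonormal W \<le> d" and f: "f \<in> W"
  shows "proj d b f = f"
proof (rule ccontr)
  assume "proj d b f \<noteq> f"
  let ?r = "\<lambda>x. f x - proj d b f x"
  have "proj d b f \<in> W" unfolding proj_def using b W by (intro invariant_space_sum) (auto simp: orthonormal_def)
  then have "?r \<in> W" using W f by (intro invariant_space_diff)
  moreover have "?r \<noteq> (\<lambda>x. 0)"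
    using \<open>proj d b f \<noteq> f\<close> by (metis eq_iff_diff_eq_0 ext)
  ultimately obtain b' where "orthonormal W (Suc d) b'"
    using orthonormal_extend[OF W b(1)] proj_orthogonal[OF b(1)] by blast
  then show False using max_orthonormal_ge[of W "Suc d" b'] b(2) by simp
qed

text \<open>Coordinates in an orthonormal basis of U carry an invariant subspace of coordinate
  vectors to an invariant space of functions inside U. If that space is nonzero, minimality gives it
  the full dimension of U, hence it is U.\<close>

lemma irreducible_rep_of_minimal:
  assumes U: "invariant_space U" and Une: "U \<noteq> {\<lambda>x. 0}"
    and minimal: "\<And>U'. invariant_space U' \<Longrightarrow> U' \<subseteq> U \<Longrightarrow> U' \<noteq> {\<lambda>x. 0} \<Longrightarrow> max_orthonormal U \<le> max_orthonormal U'"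
    and b: "orthonormal U d b" "d = max_orthonormal U"
    and \<rho>: "\<rho> = (\<lambda>g. mat d d (\<lambda>(i, j). ip (rtrans g (b j)) (b i)))"
  shows "irreducible_rep G d \<rho>"
    and "\<And>g j. g \<in> carrier G \<Longrightarrow> j < d \<Longrightarrow> rtrans g (b j) = (\<lambda>x. \<Sum>i<d. \<rho> g $$ (i, j) * b i x)"
proof -
  have bU: "b i \<in> U" if "i < d" for i using b that by (simp add: orthonormal_def)
  have bfun: "b i \<in> supported" if "i < d" for i using bU[OF that] U by (auto simp: invariant_space_def)
  show expand: "rtrans g (b j) = (\<lambda>x. \<Sum>i<d. \<rho> g $$ (i, j) * b i x)" if "g \<in> carrier G" "j < d" for g j
  proof -
    have "rtrans g (b j) \<in> U" using U bU that by (auto simp: invariant_space_def)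
    then have "rtrans g (b j) = proj d b (rtrans g (b j))" using proj_max_orthonormal[OF U b(1)] b(2) by simp
    then show ?thesis using that by (simp add: proj_def \<rho>)
  qed
  have mult: "\<rho> (g \<otimes> h) = \<rho> g * \<rho> h" if gh: "g \<in> carrier G" "h \<in> carrier G" for g h
  proof (rule eq_matI)
    fix i j assume "i < dim_row (\<rho> g * \<rho> h)" "j < dim_col (\<rho> g * \<rho> h)"
    then have ij: "i < d" "j < d" by (auto simp: \<rho>)
    have "\<rho> (g \<otimes> h) $$ (i, j) = ip (rtrans g (rtrans h (b j))) (b i)"
      using ij by (simp add: \<rho> rtrans_mult gh)
    also have "\<dots> = (\<Sum>k<d. \<rho> h $$ (k, j) * ip (rtrans g (b k)) (b i))"
      by (simp add: expand gh ij rtrans_sum ip_sum_left)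
    also have "\<dots> = (\<Sum>k<d. \<rho> g $$ (i, k) * \<rho> h $$ (k, j))"
      using ij by (intro sum.cong) (auto simp: \<rho>)
    also have "\<dots> = (\<rho> g * \<rho> h) $$ (i, j)"
      using ij by (auto simp: \<rho> scalar_prod_def atLeast0LessThan)
    finally show "\<rho> (g \<otimes> h) $$ (i, j) = (\<rho> g * \<rho> h) $$ (i, j)" .
  qed (auto simp: \<rho>)
  have one: "\<rho> \<one> = 1\<^sub>m d"
    using b(1) bfun by (intro eq_matI) (auto simp: \<rho> rtrans_one orthonormal_def)
  have rep: "is_rep G d \<rho>"
    unfolding is_rep_def hom_def
  proof safe
    fix g assume g: "g \<in> carrier G"
    have "\<rho> (inv g) * \<rho> g = 1\<^sub>m d" "\<rho> g * \<rho> (inv g) = 1\<^sub>m d"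
      using g by (simp_all add: one flip: mult)
    moreover have "\<rho> x \<in> carrier_mat d d" for x by (simp add: \<rho>)
    ultimately show "\<rho> g \<in> carrier (GL d)" unfolding GL_carrier by blast
  qed (simp add: mult GL_mult)
  have d: "d > 0"
  proof (rule ccontr)
    assume "\<not> d > 0"
    \<comment> \<open>With no basis vectors every projection is an empty sum, yet projection fixes
      each element of U.\<close>
    then have "f = (\<lambda>x. 0)" if "f \<in> U" for f
      using proj_max_orthonormal[OF U b(1) _ that] b(2) by (simp add: proj_def)
    then show False using Une U by (auto simp: invariant_space_def)
  qed
  have "W = {0\<^sub>v d} \<or> W = carrier_vec d" if W: "invariant_subspace G d \<rho> W" for W
  proof (rule disjCI)
    assume ne: "W \<noteq> carrier_vec d"
    have sub: "submodule class_ring W (module_vec TYPE(complex) d)"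
      using W by (auto simp: invariant_subspace_def subspace_def)
    have Wc: "W \<subseteq> carrier_vec d" and W0: "0\<^sub>v d \<in> W"
      and Wadd: "\<And>v w. v \<in> W \<Longrightarrow> w \<in> W \<Longrightarrow> v + w \<in> W"
      and Wsm: "\<And>c v. v \<in> W \<Longrightarrow> c \<cdot>\<^sub>v v \<in> W"
      using submodule.subset[OF sub] submodule.zero_closed[OF sub] submodule.m_closed[OF sub]
        submodule.smult_closed[OF sub]
      by (auto simp: module_vec_simps class_ring_simps)
    have Winv: "\<And>g w. g \<in> carrier G \<Longrightarrow> w \<in> W \<Longrightarrow> \<rho> g *\<^sub>v w \<in> W"
      using W by (auto simp: invariant_subspace_def)
    \<comment> \<open>The coordinate isomorphism onto U; it intertwines \<rho> with right
      translation (\<open>Frt\<close>), and its inverse reads off inner products with the basis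
      (\<open>Fip\<close>).\<close>
    define F where "F w = (\<lambda>x. \<Sum>i<d. vec_index w i * b i x)" for w :: "complex vec"
    have Fip: "ip (F w) (b j) = vec_index w j" if "j < d" for w j
      unfolding F_def by (rule orthonormal_ip_sum[OF b(1) that])
    have Frt: "rtrans g (F w) = F (\<rho> g *\<^sub>v w)" if g: "g \<in> carrier G" and w: "w \<in> carrier_vec d" for g w
    proof -
      have "rtrans g (F w) = (\<lambda>x. \<Sum>j<d. \<Sum>i<d. vec_index w j * (\<rho> g $$ (i, j) * b i x))"
        unfolding F_def rtrans_sum by (simp add: expand g sum_distrib_left)
      also have "\<dots> = (\<lambda>x. \<Sum>i<d. \<Sum>j<d. vec_index w j * (\<rho> g $$ (i, j) * b i x))"
        by (rule ext, rule sum.swap)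
      also have "\<dots> = F (\<rho> g *\<^sub>v w)"
        using w unfolding F_def
        by (auto simp: \<rho> scalar_prod_def atLeast0LessThan sum_distrib_left sum_distrib_right mult_ac intro!: sum.cong)
      finally show ?thesis .
    qed
    have FU: "F w \<in> U" for w unfolding F_def by (intro invariant_space_sum[OF U] bU) auto
    have inv: "invariant_space (F ` W)"
      unfolding invariant_space_def
    proof (intro conjI ballI allI)
      show "F ` W \<subseteq> supported" using FU U by (auto simp: invariant_space_def)
      have "F (0\<^sub>v d) = (\<lambda>x. 0)" by (simp add: F_def)
      then show "(\<lambda>x. 0) \<in> F ` W" using W0 by force
    next
      fix f h assume "f \<in> F ` W" "h \<in> F ` W"
      then obtain v w where vw: "v \<in> W" "w \<in> W" "f = F v" "h = F w" by auto
      have "(\<lambda>x. f x + h x) = F (v + w)"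
        using vw Wc by (auto simp: F_def sum.distrib distrib_right)
      then show "(\<lambda>x. f x + h x) \<in> F ` W" using Wadd vw by auto
    next
      fix c f assume "f \<in> F ` W"
      then obtain v where v: "v \<in> W" "f = F v" by auto
      have "(\<lambda>x. c * f x) = F (c \<cdot>\<^sub>v v)"
        using v Wc by (auto simp: F_def sum_distrib_left mult.assoc)
      then show "(\<lambda>x. c * f x) \<in> F ` W" using Wsm v by auto
    next
      fix g f assume "g \<in> carrier G" "f \<in> F ` W"
      then show "rtrans g f \<in> F ` W" using Frt Wc Winv by auto
    qed
    have "F ` W = {\<lambda>x. 0}"
    proof (rule ccontr)
      assume "F ` W \<noteq> {\<lambda>x. 0}"
      then have le: "max_orthonormal U \<le> max_orthonormal (F ` W)" using minimal[OF inv] FU by blast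
      obtain b' where b': "orthonormal (F ` W) (max_orthonormal (F ` W)) b'" using max_orthonormal_basis by blast
      \<comment> \<open>An orthonormal family inside the image of W is also one in U, and it is long
        enough to span U; so every \<open>F w\<close> lies in the image of W.\<close>
      then have b'U: "orthonormal U (max_orthonormal (F ` W)) b'" using FU by (auto simp: orthonormal_def)
      have "w \<in> W" if w: "w \<in> carrier_vec d" for w
      proof -
        have "F w = proj (max_orthonormal (F ` W)) b' (F w)"
          using proj_max_orthonormal[OF U b'U le FU] by simp
        also have "\<dots> \<in> F ` W"
          unfolding proj_def using b' by (intro invariant_space_sum[OF inv]) (auto simp: orthonormal_def)
        finally obtain w' where w': "w' \<in> W" "F w = F w'" by auto
        then have "vec_index w j = vec_index w' j" if "j < d" for j using Fip[OF that, of w] Fip[OF that, of w'] by simp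
        then have "w = w'" using w w' Wc by (intro eq_vecI) auto
        then show ?thesis using w' by simp
      qed
      then show False using ne Wc by auto
    qed
    then have "F w = (\<lambda>x. 0)" if "w \<in> W" for w using that by auto
    then have "w = 0\<^sub>v d" if "w \<in> W" for w
      using that Wc Fip[of _ w] by (intro eq_vecI) (auto simp: ip_def)
    then show "W = {0\<^sub>v d}" using W0 by blast
  qed
  then show "irreducible_rep G d \<rho>"
    using rep d by (simp add: irreducible_rep_def)
qed

lemma norm_sq_cong: "(\<And>x. x \<in> carrier G \<Longrightarrow> f x = h x) \<Longrightarrow> norm_sq f = norm_sq h"
  unfolding norm_sq_def by (intro avg_cong) simp

lemma norm_sq_divide: "norm_sq (\<lambda>x. f x / c) = norm_sq f / (norm c)\<^sup>2"
  by (simp add: norm_sq_def norm_divide power_divide divide_inverse[of _ "(norm c)\<^sup>2"] avg_multc)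

section \<open>Decomposition into irreducible components\<close>

text \<open>The adjoint of right translation by g is right translation by its inverse, which
  preserves U.\<close>

lemma invariant_space_complement:
  assumes W: "invariant_space W" and U: "invariant_space U"
  shows "invariant_space {w \<in> W. \<forall>u\<in>U. ip w u = 0}"
  unfolding invariant_space_def
proof (intro conjI ballI allI)
  fix g f assume "g \<in> carrier G" "f \<in> {w \<in> W. \<forall>u\<in>U. ip w u = 0}"
  then show "rtrans g f \<in> {w \<in> W. \<forall>u\<in>U. ip w u = 0}"
    using W U by (auto simp: invariant_space_def ip_rtrans_left)
qed (use W in \<open>auto simp: invariant_space_def ip_add_left ip_cmult_left, simp add: ip_def\<close>)

text \<open>Complete reducibility as an induction principle: split off the projection to a minimal
  invariant space and recurse on the orthogonal complement. In the additive case every translate of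
  a, not only a itself, is orthogonal to b, because the two parts lie in orthogonal invariant
  spaces; this kills the cross terms in the later applications.\<close>

lemma irreducible_decomposition_induct:
  assumes W: "invariant_space W" and f: "f \<in> W"
    and zero: "P (\<lambda>x. 0)"
    and add: "\<And>a b. P a \<Longrightarrow> P b \<Longrightarrow> (\<And>g. g \<in> carrier G \<Longrightarrow> ip (rtrans g a) b = 0) \<Longrightarrow> P (\<lambda>x. a x + b x)"
    and irr: "\<And>d b \<rho> c. irreducible_rep G d \<rho> \<Longrightarrow> orthonormal W d b \<Longrightarrow>
        (\<And>g j. g \<in> carrier G \<Longrightarrow> j < d \<Longrightarrow> rtrans g (b j) = (\<lambda>x. \<Sum>i<d. \<rho> g $$ (i, j) * b i x)) \<Longrightarrow>
        P (\<lambda>x. \<Sum>i<d. c i * b i x)"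
  shows "P f"
proof -
  have "P f" if "invariant_space W'" "W' \<subseteq> W" "f \<in> W'" for W' f
    using that
  proof (induction "max_orthonormal W'" arbitrary: W' f rule: less_induct)
    case less
    note W' = less.prems(1)
    show ?case
    proof (cases "f = (\<lambda>x. 0)")
      case True
      then show ?thesis using zero by simp
    next
      case False
      define R where "R U \<longleftrightarrow> invariant_space U \<and> U \<subseteq> W' \<and> U \<noteq> {\<lambda>x. 0}" for U
      have "R W'" using less.prems False by (auto simp: R_def)
      then obtain U where U: "R U" and least: "\<And>U'. R U' \<Longrightarrow> max_orthonormal U \<le> max_orthonormal U'"
        using ex_has_least_nat[of R W' max_orthonormal] by blast
      have Uinv: "invariant_space U" and UW: "U \<subseteq> W'" and Une: "U \<noteq> {\<lambda>x. 0}" using U by (auto simp: R_def)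
      define d where "d = max_orthonormal U"
      obtain b where b: "orthonormal U d b" using max_orthonormal_basis unfolding d_def by blast
      have projU: "proj d b u = u" if "u \<in> U" for u
        using proj_max_orthonormal[OF Uinv b _ that] by (simp add: d_def)
      define \<rho> where "\<rho> = (\<lambda>g. mat d d (\<lambda>(i, j). ip (rtrans g (b j)) (b i)))"
      have minimal: "max_orthonormal U \<le> max_orthonormal U'" if "invariant_space U'" "U' \<subseteq> U" "U' \<noteq> {\<lambda>x. 0}" for U'
        using least[of U'] that UW by (auto simp: R_def)
      note rep = irreducible_rep_of_minimal[OF Uinv Une minimal b d_def \<rho>_def]
      have Pproj: "P (proj d b f)"
        unfolding proj_def
      proof (rule irr[OF rep(1)])
        show "orthonormal W d b" using b UW less.prems(2) by (auto simp: orthonormal_def)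
      qed (use rep(2) in auto)
      define W2 where "W2 = {w \<in> W'. \<forall>u\<in>U. ip w u = 0}"
      have W2: "invariant_space W2" unfolding W2_def by (rule invariant_space_complement[OF W' Uinv])
      have "0 < d" using rep(1) by (auto simp: irreducible_rep_def)
      then have b0: "b 0 \<in> U" "ip (b 0) (b 0) = 1" using b by (auto simp: orthonormal_def)
      \<comment> \<open>The unit vector \<open>b 0\<close> of U is orthogonal to the whole
        complement, so it lengthens any orthonormal family of \<open>W2\<close>; this makes the
        recursion terminate.\<close>
      have dim: "max_orthonormal W2 < max_orthonormal W'"
      proof -
        obtain b2 where b2: "orthonormal W2 (max_orthonormal W2) b2" using max_orthonormal_basis by blast
        have "\<exists>b'. orthonormal W' (Suc (max_orthonormal W2)) b'"
        proof (rule orthonormal_extend[OF W'])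
          show "orthonormal W' (max_orthonormal W2) b2" using b2 by (auto simp: orthonormal_def W2_def)
          show "b 0 \<in> W'" using b0 UW by blast
          show "b 0 \<noteq> (\<lambda>x. 0)" using b0(2) by (auto simp: ip_def)
          show "ip (b 0) (b2 j) = 0" if "j < max_orthonormal W2" for j
            by (rule ip_zero_sym) (use b2 b0(1) that in \<open>auto simp: orthonormal_def W2_def\<close>)
        qed
        then show ?thesis using max_orthonormal_ge by fastforce
      qed
      let ?r = "\<lambda>x. f x - proj d b f x"
      have projmem: "proj d b f \<in> U"
        unfolding proj_def using b by (intro invariant_space_sum[OF Uinv]) (auto simp: orthonormal_def)
      have r: "?r \<in> W2"
        unfolding W2_def
      proof (intro CollectI conjI ballI)
        show "?r \<in> W'" using W' less.prems(3) projmem UW by (intro invariant_space_diff) auto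
        fix u assume "u \<in> U"
        then have "ip ?r u = ip ?r (proj d b u)" by (simp add: projU)
        also have "\<dots> = 0"
          using proj_orthogonal[OF b, of _ f] by (subst (2) proj_def) (simp add: ip_sum_right)
        finally show "ip ?r u = 0" .
      qed
      have "W2 \<subseteq> W" using less.prems(2) by (auto simp: W2_def)
      then have "P ?r" by (rule less.hyps[OF dim W2 _ r])
      moreover have "ip (rtrans g (proj d b f)) ?r = 0" if "g \<in> carrier G" for g
      proof (rule ip_zero_sym)
        have "rtrans g (proj d b f) \<in> U" using Uinv projmem that by (auto simp: invariant_space_def)
        then show "ip ?r (rtrans g (proj d b f)) = 0" using r by (simp add: W2_def)
      qed
      ultimately have "P (\<lambda>x. proj d b f x + ?r x)" using Pproj add by blast
      then show ?thesis by simp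
    qed
  qed
  then show ?thesis using W f by blast
qed

text \<open>The orthogonal complement of the constants. It contains no copy of the trivial
  representation, so quasirandomness applies to all its irreducible components.\<close>

definition mean_zero :: "('a \<Rightarrow> complex) set" where
  "mean_zero = {f \<in> supported. avg f = 0}"

lemma invariant_space_mean_zero: "invariant_space mean_zero"
proof -
  have "avg (rtrans g f) = avg f" if "g \<in> carrier G" for g f
    using avg_right[OF that, of f] by (simp add: rtrans_def cong: avg_cong)
  then show ?thesis
    by (auto simp: invariant_space_def mean_zero_def rtrans_supported avg_add avg_cmult) (auto simp: supported_def)
qed

text \<open>If \<rho> were trivial, \<open>b 0\<close> would be invariant under right translation,
  hence constant on G, hence zero by its vanishing mean; this contradicts unit norm.\<close>

lemma quasirandom_dim:
  assumes quasi: "quasirandom D G" and irr: "irreducible_rep G d \<rho>" and b: "orthonormal mean_zero d b"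
    and expand: "\<And>g j. g \<in> carrier G \<Longrightarrow> j < d \<Longrightarrow> rtrans g (b j) = (\<lambda>x. \<Sum>i<d. \<rho> g $$ (i, j) * b i x)"
  shows "D \<le> d"
proof -
  have d: "0 < d" using irr by (simp add: irreducible_rep_def)
  have "\<not> trivial_rep G d \<rho>"
  proof
    assume triv: "trivial_rep G d \<rho>"
    have const: "b 0 x = b 0 \<one>" if x: "x \<in> carrier G" for x
    proof -
      have "rtrans x (b 0) \<one> = (\<Sum>i<d. (if i = 0 then 1 else 0) * b i \<one>)"
        using triv x d by (auto simp: expand trivial_rep_def intro!: sum.cong)
      also have "\<dots> = b 0 \<one>"
        using d by (simp add: if_distrib[where f = "\<lambda>x. x * _"] sum.delta cong: if_cong)
      finally show ?thesis using x by (simp add: rtrans_def)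
    qed
    have "avg (b 0) = 0" using b d by (auto simp: orthonormal_def mean_zero_def)
    moreover have "avg (b 0) = avg (\<lambda>x. b 0 \<one>)" by (rule avg_cong) (rule const)
    ultimately have "b 0 x = 0" if "x \<in> carrier G" for x using const[OF that] by simp
    then have "ip (b 0) (b 0) = avg (\<lambda>x. 0)" unfolding ip_def by (intro avg_cong) simp
    then show False using b d by (simp add: orthonormal_def)
  qed
  then show ?thesis using quasi irr by (auto simp: quasirandom_def)
qed

section \<open>Mixing\<close>

lemma comm_avg_add: "comm_avg (\<lambda>x. a x + b x) v = comm_avg a v + comm_avg b v"
  by (simp add: comm_avg_def avg_add)

text \<open>\<open>comm_avg a\<close> is an average of right translates of a, so it inherits their
  common orthogonality to h.\<close>

lemma comm_avg_orthogonal: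
  assumes "\<And>g. g \<in> carrier G \<Longrightarrow> ip (rtrans g a) h = 0"
  shows "ip (comm_avg a) h = 0"
proof -
  have "ip (comm_avg a) h = avg (\<lambda>v. avg (\<lambda>k. avg (\<lambda>u. a (v \<otimes> (k \<otimes> u \<otimes> inv k \<otimes> inv u)) * cnj (h v))))"
    by (simp add: ip_def comm_avg_def avg_multc)
  also have "\<dots> = avg (\<lambda>k. avg (\<lambda>u. avg (\<lambda>v. a (v \<otimes> (k \<otimes> u \<otimes> inv k \<otimes> inv u)) * cnj (h v))))"
    by (subst avg_swap, subst (2) avg_swap) (rule refl)
  also have "\<dots> = avg (\<lambda>k. avg (\<lambda>u. ip (rtrans (k \<otimes> u \<otimes> inv k \<otimes> inv u) a) h))"
    unfolding ip_def rtrans_def by (intro avg_cong) simp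
  also have "\<dots> = avg (\<lambda>k. avg (\<lambda>u. 0))"
    by (intro avg_cong assms) simp
  finally show ?thesis by simp
qed

lemma comm_avg_irreducible:
  assumes irr: "irreducible_rep G d \<rho>"
    and expand: "\<And>g j. g \<in> carrier G \<Longrightarrow> j < d \<Longrightarrow> rtrans g (b j) = (\<lambda>x. \<Sum>i<d. \<rho> g $$ (i, j) * b i x)"
    and v: "v \<in> carrier G"
  shows "comm_avg (\<lambda>x. \<Sum>i<d. c i * b i x) v = (\<Sum>i<d. c i * b i v) / (of_nat d)\<^sup>2"
proof -
  let ?k = "\<lambda>k u. k \<otimes> u \<otimes> inv k \<otimes> inv u"
  have "comm_avg (b j) v = b j v / (of_nat d)\<^sup>2" if j: "j < d" for j
  proof -
    have "comm_avg (b j) v = avg (\<lambda>k. avg (\<lambda>u. rtrans (?k k u) (b j) v))"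
      unfolding comm_avg_def using v by (intro avg_cong) (simp add: rtrans_def)
    also have "\<dots> = avg (\<lambda>k. avg (\<lambda>u. \<Sum>i<d. \<rho> (?k k u) $$ (i, j) * b i v))"
      using j by (intro avg_cong) (simp add: expand)
    also have "\<dots> = (\<Sum>i<d. avg (\<lambda>k. avg (\<lambda>u. \<rho> (?k k u) $$ (i, j))) * b i v)"
      by (simp add: avg_sum avg_multc)
    also have "\<dots> = (\<Sum>i<d. if i = j then b i v / (of_nat d)\<^sup>2 else 0)"
      using j by (intro sum.cong) (auto simp: commutator_average[OF irr])
    also have "\<dots> = b j v / (of_nat d)\<^sup>2" using j by simp
    finally show ?thesis .
  qed
  moreover have "comm_avg (\<lambda>x. \<Sum>i<d. c i * b i x) v = (\<Sum>i<d. c i * comm_avg (b i) v)"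
    by (simp add: comm_avg_def avg_sum avg_cmult)
  ultimately show ?thesis by (simp add: sum_divide_distrib)
qed

text \<open>A component of dimension d is scaled by 1/d^2, so its squared norm shrinks by d^4, and
  images of orthogonal components stay orthogonal. The weaker factor 1/D is enough, because the
  autocorrelation term of the final estimate is itself only bounded by 1/D.\<close>

lemma comm_avg_contraction:
  assumes D: "D > 0" and quasi: "quasirandom D G" and f: "f \<in> mean_zero"
  shows "norm_sq (comm_avg f) \<le> norm_sq f / D"
  using invariant_space_mean_zero f
proof (rule irreducible_decomposition_induct)
  show "norm_sq (comm_avg (\<lambda>x. 0)) \<le> norm_sq (\<lambda>x. 0) / D"
    by (simp add: norm_sq_def comm_avg_def)
next
  fix a b assume ab: "norm_sq (comm_avg a) \<le> norm_sq a / D" "norm_sq (comm_avg b) \<le> norm_sq b / D"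
    and ort: "\<And>g. g \<in> carrier G \<Longrightarrow> ip (rtrans g a) b = 0"
  have "ip (comm_avg a) (comm_avg b) = 0"
  proof (rule comm_avg_orthogonal, rule ip_zero_sym, rule comm_avg_orthogonal, rule ip_zero_sym)
    fix g h assume [simp]: "g \<in> carrier G" "h \<in> carrier G"
    have "ip (rtrans g a) (rtrans h b) = ip (rtrans (inv h \<otimes> g) a) b"
      by (simp add: rtrans_mult ip_rtrans_left[of "inv h"])
    then show "ip (rtrans g a) (rtrans h b) = 0" by (simp add: ort)
  qed
  then have "norm_sq (\<lambda>x. comm_avg a x + comm_avg b x) = norm_sq (comm_avg a) + norm_sq (comm_avg b)"
    by (rule norm_sq_orthogonal_add)
  moreover have "norm_sq (\<lambda>x. a x + b x) = norm_sq a + norm_sq b"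
    using ort[of \<one>] ip_rtrans_left[of \<one> a b]
    by (intro norm_sq_orthogonal_add) (simp add: ip_def rtrans_def cong: avg_cong)
  ultimately show "norm_sq (comm_avg (\<lambda>x. a x + b x)) \<le> norm_sq (\<lambda>x. a x + b x) / D"
    using ab by (simp add: comm_avg_add[abs_def] add_divide_distrib)
next
  fix d b \<rho> c
  assume irr: "irreducible_rep G d \<rho>" and b: "orthonormal mean_zero d b"
    and expand: "\<And>g j. g \<in> carrier G \<Longrightarrow> j < d \<Longrightarrow> rtrans g (b j) = (\<lambda>x. \<Sum>i<d. \<rho> g $$ (i, j) * b i x)"
  let ?f = "\<lambda>x. \<Sum>i<d. c i * b i x"
  have dD: "D \<le> d" by (rule quasirandom_dim[OF quasi irr b expand])
  have "norm_sq (comm_avg ?f) = norm_sq (\<lambda>x. ?f x / (of_nat d)\<^sup>2)"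
    by (rule norm_sq_cong) (rule comm_avg_irreducible[OF irr expand])
  also have "\<dots> = norm_sq ?f / (of_nat d) ^ 4"
    by (simp add: norm_sq_divide norm_power)
  also have "\<dots> \<le> norm_sq ?f / D"
  proof (rule divide_left_mono)
    have "real D \<le> real d ^ 1" using dD by simp
    also have "\<dots> \<le> real d ^ 4" using dD D by (intro power_increasing) auto
    finally show "real D \<le> real d ^ 4" .
  qed (use norm_sq_nonneg D dD in auto)
  finally show "norm_sq (comm_avg ?f) \<le> norm_sq ?f / D" .
qed

lemma sqrt_avg_triangle:
  fixes a b :: "'a \<Rightarrow> complex"
  shows "sqrt (avg (\<lambda>x. (norm (a x + b x))\<^sup>2)) \<le> sqrt (avg (\<lambda>x. (norm (a x))\<^sup>2)) + sqrt (avg (\<lambda>x. (norm (b x))\<^sup>2))"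
proof -
  let ?L = "\<lambda>f. L2_set f (carrier G)" and ?n = "sqrt (card (carrier G))"
  have eq: "sqrt (avg (\<lambda>x. (f x)\<^sup>2)) = ?L f / ?n" for f :: "'a \<Rightarrow> real"
    by (simp add: avg_def L2_set_def real_sqrt_divide)
  have "?L (\<lambda>x. norm (a x + b x)) \<le> ?L (\<lambda>x. norm (a x) + norm (b x))"
    by (intro L2_set_mono norm_triangle_ineq) auto
  also have "\<dots> \<le> ?L (\<lambda>x. norm (a x)) + ?L (\<lambda>x. norm (b x))"
    by (rule L2_set_triangle_ineq)
  finally show ?thesis
    unfolding eq by (simp add: divide_right_mono flip: add_divide_distrib)
qed

text \<open>Stated with square roots because Minkowski's inequality then makes the bound additive over
  orthogonal components.\<close>

lemma autocorrelation_bound_sqrt: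
  assumes D: "D > 0" and quasi: "quasirandom D G" and f: "f \<in> mean_zero"
  shows "sqrt (avg (\<lambda>g. (norm (ip (rtrans g f) f))\<^sup>2)) \<le> norm_sq f / sqrt D"
  using invariant_space_mean_zero f
proof (rule irreducible_decomposition_induct)
  show "sqrt (avg (\<lambda>g. (norm (ip (rtrans g (\<lambda>x. 0)) (\<lambda>x. 0)))\<^sup>2)) \<le> norm_sq (\<lambda>x. 0) / sqrt D"
    by (simp add: norm_sq_def ip_def)
next
  let ?S = "\<lambda>f. sqrt (avg (\<lambda>g. (norm (ip (rtrans g f) f))\<^sup>2))"
  fix a b assume ab: "?S a \<le> norm_sq a / sqrt D" "?S b \<le> norm_sq b / sqrt D"
    and ort: "\<And>g. g \<in> carrier G \<Longrightarrow> ip (rtrans g a) b = 0"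
  have ort': "ip (rtrans g b) a = 0" if "g \<in> carrier G" for g
    using ip_zero_sym[OF ort[of "inv g"]] that by (simp add: ip_rtrans_left)
  have norm_sq: "norm_sq (\<lambda>x. a x + b x) = norm_sq a + norm_sq b"
    using ort[of \<one>] ip_rtrans_left[of \<one> a b]
    by (intro norm_sq_orthogonal_add) (simp add: ip_def rtrans_def cong: avg_cong)
  \<comment> \<open>The cross correlations vanish for every g, so the autocorrelation of the sum is
    the sum of the two autocorrelations and Minkowski applies.\<close>
  have "?S (\<lambda>x. a x + b x) = sqrt (avg (\<lambda>g. (norm (ip (rtrans g a) a + ip (rtrans g b) b))\<^sup>2))"
    by (intro arg_cong[where f = sqrt] avg_cong)
       (simp add: rtrans_add ip_add_left ip_add_right ort ort')
  also have "\<dots> \<le> ?S a + ?S b" by (rule sqrt_avg_triangle)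
  also have "\<dots> \<le> norm_sq a / sqrt D + norm_sq b / sqrt D" using ab by (rule add_mono)
  finally show "?S (\<lambda>x. a x + b x) \<le> norm_sq (\<lambda>x. a x + b x) / sqrt D"
    by (simp add: norm_sq add_divide_distrib)
next
  fix d b \<rho> c
  assume irr: "irreducible_rep G d \<rho>" and b: "orthonormal mean_zero d b"
    and expand: "\<And>g j. g \<in> carrier G \<Longrightarrow> j < d \<Longrightarrow> rtrans g (b j) = (\<lambda>x. \<Sum>i<d. \<rho> g $$ (i, j) * b i x)"
  let ?f = "\<lambda>x. \<Sum>i<d. c i * b i x"
  have dD: "D \<le> d" by (rule quasirandom_dim[OF quasi irr b expand])
  define T where "T g = ip (rtrans g ?f) ?f" for g
  have T: "T g = (\<Sum>i<d. \<Sum>j<d. cnj (c i) * c j * \<rho> g $$ (i, j))" if g: "g \<in> carrier G" for g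
  proof -
    have "ip (rtrans g (b j)) ?f = (\<Sum>i<d. cnj (c i) * \<rho> g $$ (i, j))" if "j < d" for j
    proof -
      have "ip (\<lambda>x. \<Sum>i<d. \<rho> g $$ (i, j) * b i x) (b i) = \<rho> g $$ (i, j)" if "i < d" for i
        by (rule orthonormal_ip_sum[OF b that])
      then show ?thesis using that g by (simp add: expand ip_sum_right)
    qed
    then have "T g = (\<Sum>j<d. c j * (\<Sum>i<d. cnj (c i) * \<rho> g $$ (i, j)))"
      unfolding T_def rtrans_sum ip_sum_left by simp
    also have "\<dots> = (\<Sum>j<d. \<Sum>i<d. cnj (c i) * c j * \<rho> g $$ (i, j))"
      by (simp add: sum_distrib_left mult_ac)
    also have "\<dots> = (\<Sum>i<d. \<Sum>j<d. cnj (c i) * c j * \<rho> g $$ (i, j))"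
      by (rule sum.swap)
    finally show ?thesis .
  qed
  \<comment> \<open>Conjugation becomes inversion of g, the form in which
    \<open>schur_orthogonality\<close> pairs matrix entries.\<close>
  have cnjT: "cnj (T g) = T (inv g)" if "g \<in> carrier G" for g
    using that by (simp add: T_def cnj_ip ip_rtrans_left)
  have nf: "of_real (norm_sq ?f) = (\<Sum>i<d. cnj (c i) * c i)"
    unfolding norm_sq_sum[OF b] by (simp add: complex_norm_square mult.commute del: of_real_power)
  have "of_real (avg (\<lambda>g. (norm (T g))\<^sup>2)) = avg (\<lambda>g. T g * cnj (T g))"
    by (simp only: of_real_avg complex_norm_square)
  also have "\<dots> = avg (\<lambda>g. \<Sum>a<d. \<Sum>i<d. cnj (c a) * c i * \<rho> g $$ (a, i) * T (inv g))"
    by (rule avg_cong, simp only: cnjT, subst T, assumption, simp only: sum_distrib_right)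
  also have "\<dots> = avg (\<lambda>g. \<Sum>a<d. \<Sum>i<d. \<Sum>j<d. \<Sum>k<d. cnj (c a) * c i * (cnj (c j) * c k) * (\<rho> g $$ (a, i) * \<rho> (inv g) $$ (j, k)))"
    by (rule avg_cong) (simp add: T sum_distrib_left mult_ac)
  also have "\<dots> = (\<Sum>a<d. \<Sum>i<d. \<Sum>j<d. \<Sum>k<d. cnj (c a) * c i * (cnj (c j) * c k) * avg (\<lambda>g. \<rho> g $$ (a, i) * \<rho> (inv g) $$ (j, k)))"
    by (simp only: avg_sum avg_cmult)
  \<comment> \<open>Orthogonality identifies k with a and j with i. The four coefficients then pair
    into two squared moduli, and the sum factors as the square of \<open>norm_sq ?f\<close> divided
    by d.\<close>
  also have "\<dots> = (\<Sum>a<d. \<Sum>i<d. \<Sum>j<d. \<Sum>k<d. if k = a then if j = i then cnj (c a) * c i * (cnj (c j) * c k) / of_nat d else 0 else 0)"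
    by (intro sum.cong refl) (auto simp: schur_orthogonality[OF irr])
  also have "\<dots> = (\<Sum>a<d. \<Sum>i<d. (cnj (c a) * c a) * (cnj (c i) * c i) / of_nat d)"
    by (intro sum.cong refl) (simp add: mult_ac)
  also have "\<dots> = of_real ((norm_sq ?f)\<^sup>2 / of_nat d)"
    by (simp add: nf power2_eq_square sum_product sum_divide_distrib)
  finally have avgT: "avg (\<lambda>g. (norm (T g))\<^sup>2) = (norm_sq ?f)\<^sup>2 / d"
    using of_real_eq_iff by blast
  have "sqrt (avg (\<lambda>g. (norm (T g))\<^sup>2)) = norm_sq ?f / sqrt d"
    unfolding avgT by (simp add: real_sqrt_divide norm_sq_nonneg)
  also have "\<dots> \<le> norm_sq ?f / sqrt D"
    using D dD norm_sq_nonneg by (intro divide_left_mono) auto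
  finally show "sqrt (avg (\<lambda>g. (norm (ip (rtrans g ?f) ?f))\<^sup>2)) \<le> norm_sq ?f / sqrt D"
    by (simp add: T_def)
qed

text \<open>Both sides average f over the same quadruples v, v g, s v, s v g, grouped in two ways.
  This connects the left shifts produced by \<open>corr_conj_bound\<close> to the right translations
  for which the decomposition is available.\<close>

lemma left_autocorrelation:
  "avg (\<lambda>s. (norm (avg (\<lambda>v. f v * cnj (f (s \<otimes> v)))))\<^sup>2) = avg (\<lambda>g. (norm (ip (rtrans g f) f))\<^sup>2)"
proof -
  have left: "avg (\<lambda>v. f v * cnj (f (s \<otimes> v))) = corr f s \<one>" if "s \<in> carrier G" for s
    unfolding corr_def using that by (intro avg_cong) simp
  have right: "norm (ip (rtrans g f) f) = norm (corr f \<one> g)" if "g \<in> carrier G" for g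
  proof -
    have "cnj (ip (rtrans g f) f) = corr f \<one> g"
      unfolding corr_def ip_def cnj_avg using that by (intro avg_cong) (simp add: rtrans_def mult.commute)
    then show ?thesis using complex_mod_cnj by metis
  qed
  have "of_real (avg (\<lambda>s. (norm (avg (\<lambda>v. f v * cnj (f (s \<otimes> v)))))\<^sup>2))
     = avg (\<lambda>s. of_real ((norm (corr f s \<one>))\<^sup>2))"
    unfolding of_real_avg by (intro avg_cong) (simp add: left)
  also have "\<dots> = avg (\<lambda>s. avg (\<lambda>v. avg (\<lambda>w. f v * cnj (f w) * cnj (f (s \<otimes> v) * cnj (f (s \<otimes> w))))))"
    unfolding corr_norm_sq avg2_def by (intro avg_cong) simp
  also have "\<dots> = avg (\<lambda>s. avg (\<lambda>v. avg (\<lambda>g. f v * cnj (f (v \<otimes> g)) * cnj (f (s \<otimes> v) * cnj (f (s \<otimes> (v \<otimes> g)))))))"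
    by (rule avg_cong, rule avg_cong, rule avg_left[symmetric])
  also have "\<dots> = avg (\<lambda>v. avg (\<lambda>g. avg (\<lambda>s. f v * cnj (f (v \<otimes> g)) * cnj (f (s \<otimes> v) * cnj (f (s \<otimes> (v \<otimes> g)))))))"
    by (subst avg_swap, subst (2) avg_swap) (rule refl)
  \<comment> \<open>With \<open>s = w \<otimes> inv v\<close> the two left-shifted points become w
    and w g, and the four factors regroup as a right correlation by g.\<close>
  also have "\<dots> = avg (\<lambda>v. avg (\<lambda>g. avg (\<lambda>w. f v * cnj (f (v \<otimes> g)) *
        cnj (f (w \<otimes> inv v \<otimes> v) * cnj (f (w \<otimes> inv v \<otimes> (v \<otimes> g)))))))"
    by (rule avg_cong, rule avg_cong, rule avg_right[symmetric]) simp
  also have "\<dots> = avg (\<lambda>v. avg (\<lambda>g. avg (\<lambda>w. f v * cnj (f w) *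
        cnj (f (\<one> \<otimes> v \<otimes> g) * cnj (f (\<one> \<otimes> w \<otimes> g))))))"
    by (intro avg_cong) (simp add: m_assoc mult_ac)
  also have "\<dots> = avg (\<lambda>g. of_real ((norm (corr f \<one> g))\<^sup>2))"
    unfolding corr_norm_sq avg2_def by (rule avg_swap)
  also have "\<dots> = of_real (avg (\<lambda>g. (norm (ip (rtrans g f) f))\<^sup>2))"
    unfolding of_real_avg by (intro avg_cong) (simp add: right)
  finally show ?thesis using of_real_eq_iff by blast
qed

text \<open>K fixes constants and keeps mean-zero functions orthogonal to them, so the mean of
  \<phi> and its mean-zero part contribute separately; only the latter is contracted.\<close>

lemma comm_avg_bound:
  assumes D: "D > 0" and quasi: "quasirandom D G" and \<phi>: "\<phi> \<in> supported"
  shows "norm_sq (comm_avg \<phi>) \<le> (norm (avg \<phi>))\<^sup>2 + norm_sq \<phi> / D"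
proof -
  define m where "m = avg \<phi>"
  define \<psi> where "\<psi> = (\<lambda>x. if x \<in> carrier G then \<phi> x - m else 0)"
  have "avg \<psi> = avg (\<lambda>x. \<phi> x - m)" unfolding \<psi>_def by (rule avg_cong) simp
  then have avg0: "avg \<psi> = 0" by (simp add: avg_diff m_def)
  then have \<psi>: "\<psi> \<in> mean_zero" by (simp add: mean_zero_def supported_def \<psi>_def)
  have "norm_sq \<phi> = norm_sq (\<lambda>x. \<psi> x + m)" by (rule norm_sq_cong) (simp add: \<psi>_def)
  also have "\<dots> = norm_sq \<psi> + norm_sq (\<lambda>x. m)"
    by (rule norm_sq_orthogonal_add) (simp add: ip_def avg_multc avg0)
  finally have le: "norm_sq \<psi> \<le> norm_sq \<phi>" using norm_sq_nonneg[of "\<lambda>x. m"] by simp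
  have "ip (comm_avg \<psi>) (\<lambda>x. m) = 0"
  proof (rule comm_avg_orthogonal)
    fix g assume "g \<in> carrier G"
    then have "rtrans g \<psi> \<in> mean_zero" using invariant_space_mean_zero \<psi> by (auto simp: invariant_space_def)
    then show "ip (rtrans g \<psi>) (\<lambda>x. m) = 0" by (simp add: ip_def avg_multc mean_zero_def)
  qed
  then have "norm_sq (\<lambda>x. comm_avg \<psi> x + m) = norm_sq (comm_avg \<psi>) + norm_sq (\<lambda>x. m)"
    by (rule norm_sq_orthogonal_add)
  moreover have "norm_sq (comm_avg \<phi>) = norm_sq (\<lambda>x. comm_avg \<psi> x + m)"
  proof (rule norm_sq_cong)
    fix v assume v: "v \<in> carrier G"
    have "comm_avg \<phi> v = comm_avg (\<lambda>x. \<psi> x + m) v"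
      unfolding comm_avg_def using v by (intro avg_cong) (simp add: \<psi>_def)
    then show "comm_avg \<phi> v = comm_avg \<psi> v + m"
      by (simp add: comm_avg_add) (simp add: comm_avg_def)
  qed
  moreover have "norm_sq (\<lambda>x. m) = (norm m)\<^sup>2" by (simp add: norm_sq_def)
  moreover have "norm_sq (comm_avg \<psi>) \<le> norm_sq \<psi> / D" by (rule comm_avg_contraction[OF D quasi \<psi>])
  moreover have "\<dots> \<le> norm_sq \<phi> / D" using le D by (simp add: divide_right_mono)
  ultimately show ?thesis by (simp add: m_def)
qed

text \<open>\<open>comm_avg_bound\<close> is applied to v -> f(v) cnj(f(s v)) for each s. The means
  are autocorrelations of f and contribute at most 1/D on average; the remaining parts contribute
  the fourth power of the norm of f over D, again at most 1/D.\<close>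

lemma mean_zero_progression_bound:
  assumes D: "D > 0" and quasi: "quasirandom D G" and f: "f \<in> mean_zero" and nf: "norm_sq f \<le> 1"
    and f1: "\<And>x. x \<in> carrier G \<Longrightarrow> norm (f1 x) \<le> 1"
    and f2: "\<And>x. x \<in> carrier G \<Longrightarrow> norm (f2 x) \<le> 1"
  shows "(norm (avg2 (\<lambda>x y. f1 x * f2 (x \<otimes> y) * f (x \<otimes> (y \<otimes> y))))) ^ 4 \<le> sqrt (2 / D)"
proof -
  let ?\<phi> = "\<lambda>s v. f v * cnj (f (s \<otimes> v))" and ?Q = "avg2 (\<lambda>g u. (norm (corr f g (inv u \<otimes> g \<otimes> u)))\<^sup>2)"
  have sq1: "(norm_sq f)\<^sup>2 \<le> 1" using nf norm_sq_nonneg by (rule power_le_one[rotated])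
  have "?Q\<^sup>2 \<le> avg2 (\<lambda>s v. (norm (comm_avg (?\<phi> s) v))\<^sup>2)"
    using nf unfolding norm_sq_def by (rule corr_conj_bound)
  also have "\<dots> = avg (\<lambda>s. norm_sq (comm_avg (?\<phi> s)))"
    by (simp add: avg2_def norm_sq_def)
  also have "\<dots> \<le> avg (\<lambda>s. (norm (avg (?\<phi> s)))\<^sup>2 + norm_sq (?\<phi> s) / D)"
    using f by (intro avg_mono comm_avg_bound[OF D quasi]) (simp add: mean_zero_def supported_def)
  also have "\<dots> = avg (\<lambda>g. (norm (ip (rtrans g f) f))\<^sup>2) + avg (\<lambda>s. norm_sq (?\<phi> s)) / D"
    by (simp add: avg_add left_autocorrelation divide_inverse avg_multc)
  also have "avg (\<lambda>s. norm_sq (?\<phi> s)) = (norm_sq f)\<^sup>2"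
  proof -
    have "avg (\<lambda>s. norm_sq (?\<phi> s)) = avg (\<lambda>v. avg (\<lambda>s. (norm (f v))\<^sup>2 * (norm (f (s \<otimes> v)))\<^sup>2))"
      unfolding norm_sq_def by (subst avg_swap) (simp add: norm_mult power_mult_distrib)
    also have "\<dots> = avg (\<lambda>v. (norm (f v))\<^sup>2 * norm_sq f)"
      unfolding norm_sq_def avg_cmult by (rule avg_cong) (simp add: avg_right[of _ "\<lambda>x. (norm (f x))\<^sup>2"])
    finally show ?thesis by (simp add: avg_multc norm_sq_def power2_eq_square)
  qed
  also have "avg (\<lambda>g. (norm (ip (rtrans g f) f))\<^sup>2) \<le> 1 / D"
  proof -
    have "avg (\<lambda>g. (norm (ip (rtrans g f) f))\<^sup>2) = (sqrt (avg (\<lambda>g. (norm (ip (rtrans g f) f))\<^sup>2)))\<^sup>2"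
      by (simp add: avg_nonneg)
    also have "\<dots> \<le> (norm_sq f / sqrt D)\<^sup>2"
      by (rule power_mono[OF autocorrelation_bound_sqrt[OF D quasi f]]) (simp add: avg_nonneg)
    also have "\<dots> \<le> 1 / D" using sq1 by (simp add: power_divide divide_right_mono)
    finally show ?thesis .
  qed
  also have "1 / real D + (norm_sq f)\<^sup>2 / D \<le> 1 / D + 1 / D"
    by (intro add_left_mono divide_right_mono sq1) simp
  finally have "?Q\<^sup>2 \<le> 2 / D" by simp
  then have "?Q \<le> sqrt (2 / D)" by (rule real_le_rsqrt)
  then show ?thesis by (rule order_trans[OF progression_bound, rotated 2]) (rule f1 f2; assumption)+
qed

section \<open>Arbitrary bounded functions and the expectations of the statement\<close>

lemma expect_eq_avg: "expect (carrier G) F = avg F"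
  using fin by (subst expect_eq_average) (auto simp: avg_def)

lemma expect_eq_avg2: "expect (carrier G \<times> carrier G) (\<lambda>(x, y). F x y) = avg2 F"
  using fin by (subst expect_eq_average)
    (auto simp: avg2_eq_sum case_prod_unfold card_cartesian_product power2_eq_square)

lemma norm_le_sup_norm: "x \<in> carrier G \<Longrightarrow> norm (h x) \<le> sup_norm G h"
  unfolding sup_norm_def using fin by (intro Max_ge) auto

lemma progression_mixing:
  fixes f1 f2 f3 :: "'a \<Rightarrow> complex"
  assumes D: "D > 0" and quasi: "quasirandom D G"
    and f1: "\<And>x. x \<in> carrier G \<Longrightarrow> norm (f1 x) \<le> 1"
    and f2: "\<And>x. x \<in> carrier G \<Longrightarrow> norm (f2 x) \<le> 1"
    and f3: "\<And>x. x \<in> carrier G \<Longrightarrow> norm (f3 x) \<le> 1"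
  shows "norm (avg2 (\<lambda>x y. f1 x * f2 (x \<otimes> y) * f3 (x \<otimes> (y \<otimes> y))) - avg f1 * avg f2 * avg f3) ^ 4
    \<le> sqrt (2 / D)"
proof -
  define m where "m = avg f3"
  define f where "f = (\<lambda>x. if x \<in> carrier G then f3 x - m else 0)"
  have "avg f = avg (\<lambda>x. f3 x - m)" unfolding f_def by (rule avg_cong) simp
  then have avg0: "avg f = 0" by (simp add: avg_diff m_def)
  then have f: "f \<in> mean_zero" by (simp add: mean_zero_def supported_def f_def)
  have "norm_sq f3 = norm_sq (\<lambda>x. f x + m)" by (rule norm_sq_cong) (simp add: f_def)
  also have "\<dots> = norm_sq f + norm_sq (\<lambda>x. m)"
    by (rule norm_sq_orthogonal_add) (simp add: ip_def avg_multc avg0)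
  \<comment> \<open>Subtracting the mean can push the sup norm above 1 but cannot increase the L2
    norm, which is why the mean-zero bound asks only for the latter.\<close>
  finally have "norm_sq f \<le> norm_sq f3" using norm_sq_nonneg[of "\<lambda>x. m"] by simp
  also have "\<dots> \<le> avg (\<lambda>x. 1)"
    unfolding norm_sq_def by (intro avg_mono power_le_one f3) auto
  finally have nf: "norm_sq f \<le> 1" by simp
  have "avg2 (\<lambda>x y. f1 x * f2 (x \<otimes> y) * f3 (x \<otimes> (y \<otimes> y)))
     = avg2 (\<lambda>x y. f1 x * f2 (x \<otimes> y) * f (x \<otimes> (y \<otimes> y)) + f1 x * (f2 (x \<otimes> y) * m))"
    by (rule avg2_cong) (simp add: f_def algebra_simps)
  also have "\<dots> = avg2 (\<lambda>x y. f1 x * f2 (x \<otimes> y) * f (x \<otimes> (y \<otimes> y))) + avg (\<lambda>x. f1 x * (avg (\<lambda>y. f2 (x \<otimes> y)) * m))"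
    by (simp add: avg2_def avg_add avg_cmult avg_multc)
  also have "avg (\<lambda>x. f1 x * (avg (\<lambda>y. f2 (x \<otimes> y)) * m)) = avg (\<lambda>x. f1 x * (avg f2 * m))"
    by (rule avg_cong) (simp add: avg_left)
  also have "\<dots> = avg f1 * avg f2 * avg f3"
    by (simp add: avg_multc m_def)
  finally show ?thesis
    using mean_zero_progression_bound[of D f f1 f2] D quasi f nf f1 f2 by simp
qed

end

theorem theorem1p1:
  fixes G (structure) and D :: nat and f :: "nat \<Rightarrow> 'a \<Rightarrow> complex"
  assumes "D > 1"
    and "quasirandom D (G :: ('a, 'b) monoid_scheme)"
    and "\<And>i. i \<in> {1..3} \<Longrightarrow> sup_norm G (f i) \<le> 1"
  shows "norm (expect (carrier G \<times> carrier G)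
                 (\<lambda>(x, y). f 1 x * f 2 (x \<otimes> y) * f 3 (x \<otimes> (y [^] (2::nat))))
               - (\<Prod>i=1..3. expect (carrier G) (f i)))
         \<le> (2 / sqrt (real D)) powr (1 / 4)"
proof -
  interpret fin_group G
    using assms(2) by (auto simp: quasirandom_def fin_group_def fin_group_axioms_def)
  have bound: "norm (f i x) \<le> 1" if "i \<in> {1..3}" "x \<in> carrier G" for i x
    using norm_le_sup_norm[OF that(2), of "f i"] assms(3)[OF that(1)] by linarith
  let ?E = "norm (expect (carrier G \<times> carrier G)
                 (\<lambda>(x, y). f 1 x * f 2 (x \<otimes> y) * f 3 (x \<otimes> (y [^] (2::nat))))
               - (\<Prod>i=1..3. expect (carrier G) (f i)))"
  have "avg2 (\<lambda>x y. f 1 x * f 2 (x \<otimes> y) * f 3 (x \<otimes> (y [^] (2::nat))))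
      = avg2 (\<lambda>x y. f 1 x * f 2 (x \<otimes> y) * f 3 (x \<otimes> (y \<otimes> y)))"
    by (rule avg2_cong) (simp add: numeral_2_eq_2)
  moreover have "{1..3::nat} = {1, 2, 3}" by auto
  ultimately have "?E = norm (avg2 (\<lambda>x y. f 1 x * f 2 (x \<otimes> y) * f 3 (x \<otimes> (y \<otimes> y)))
      - avg (f 1) * avg (f 2) * avg (f 3))"
    by (simp add: expect_eq_avg expect_eq_avg2 mult.assoc)
  then have "?E ^ 4 \<le> sqrt (2 / D)"
    using progression_mixing[of D "f 1" "f 2" "f 3"] assms(1,2) bound by simp
  also have "\<dots> = sqrt 2 / sqrt D" by (rule real_sqrt_divide)
  \<comment> \<open>The argument yields the constant sqrt 2; it is relaxed to 2 to match the claimed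
    form.\<close>
  also have "\<dots> \<le> 2 / sqrt D"
    by (intro divide_right_mono real_le_lsqrt) auto
  finally have "(?E ^ 4) powr (1 / 4) \<le> (2 / sqrt D) powr (1 / 4)"
    by (intro powr_mono2) auto
  moreover have "(?E ^ 4) powr (1 / 4) = ?E"
    by (cases "?E = 0") (simp_all add: powr_powr flip: powr_numeral)
  ultimately show ?thesis by simp
qed

end
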